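(* Let $n\ge 3$, $d\ge 1$, let $\delta=\sum_{i=1}^n\varepsilon_i\,dx_i\otimes dx_i$ with $\varepsilon_i=\pm1$ on $\mathbb R^n$, let $(F^d,g_F)$ be a semi-Riemannian manifold with constant scalar curvature $\lambda_F=0$, let $\alpha\in\mathbb R^n$ be nonzero, $\xi(x)=\sum_i\alpha_ix_i$, and assume $\|\alpha\|^2=\sum_i\varepsilon_i\alpha_i^2=0$. Given two smooth functions $\varphi,f:(a,b)\to(0,\infty)$, and a smooth function $h:(a,b)\to(0,\infty)$, the metric $$g=\frac{\delta}{\varphi(\xi(x))^2}+f(\xi(x))^2g_F\quad\text{on }\xi^{-1}((a,b))\times F^d$$ is a steady gradient Yamabe soliton with potential function $h\circ\xi$ if and only if $$h(\xi)=k_1\int\frac{1}{\varphi^2(\xi)}\,d\xi$$ for some constant $k_1\in\mathbb R$.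
   Context: A semi-Riemannian manifold $(M,g)$ is a gradient Yamabe soliton with potential function $u\in C^\infty(M)$ and soliton constant $\rho\in\mathbb R$ if $(S_g-\rho)g=\mathrm{Hess}_g(u)$, where $S_g$ is the scalar curvature of $g$; it is steady if $\rho=0$. The function $h\circ\xi$ is regarded as a function on $\xi^{-1}((a,b))\times F$ via the projection to the first factor. The integral is indefinite: the formula for $h$ means $h'=k_1/\varphi^2$ on $(a,b)$ (an additive constant is allowed). *)

theory Defs
  imports "HOL-Analysis.Analysis"
begin

text \<open>Smooth functions on an open set: all iterated directional derivatives exist and are
  continuous. On sets that are not open the predicate is not meant to be used.\<close>

primrec Ck_on :: "nat \<Rightarrow> 'a::euclidean_space set \<Rightarrow> ('a \<Rightarrow> 'b::real_normed_vector) \<Rightarrow> bool" where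
  "Ck_on 0 S f \<longleftrightarrow> continuous_on S f"
| "Ck_on (Suc k) S f \<longleftrightarrow> (\<forall>x\<in>S. f differentiable (at x)) \<and>
     (\<forall>v. Ck_on k S (\<lambda>x. frechet_derivative f (at x) v))"

definition smooth_on :: "'a::euclidean_space set \<Rightarrow> ('a \<Rightarrow> 'b::real_normed_vector) \<Rightarrow> bool" where
  "smooth_on S f \<longleftrightarrow> (\<forall>k. Ck_on k S f)"

definition pd :: "'m::finite \<Rightarrow> (real^'m \<Rightarrow> real) \<Rightarrow> real^'m \<Rightarrow> real" where
  "pd i F y = frechet_derivative F (at y) (axis i 1)"


section \<open>Smooth manifolds\<close>

text \<open>A manifold of dimension \<open>CARD('m)\<close> is given by a topological space with an indexed smooth
  atlas; the chart with index \<open>i\<close> is the map \<open>coord M i\<close> on the open set \<open>cdom M i\<close>.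
  The atlas is not required to be maximal: it stands for the smooth structure it generates.
  Manifolds need not be connected.\<close>

record ('i, 'a, 'm) atlas =
  mtop :: "'a topology"
  charts :: "'i set"
  cdom :: "'i \<Rightarrow> 'a set"
  coord :: "'i \<Rightarrow> 'a \<Rightarrow> real^'m"

definition cimage :: "('i, 'a, 'm::finite) atlas \<Rightarrow> 'i \<Rightarrow> (real^'m) set" where
  "cimage M i = coord M i ` cdom M i"

definition param :: "('i, 'a, 'm::finite) atlas \<Rightarrow> 'i \<Rightarrow> real^'m \<Rightarrow> 'a" where
  "param M i = inv_into (cdom M i) (coord M i)"

definition smooth_manifold :: "('i, 'a, 'm::finite) atlas \<Rightarrow> bool" where
  "smooth_manifold M \<longleftrightarrow>
     Hausdorff_space (mtop M) \<and> second_countable (mtop M) \<and>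
     (\<Union>i\<in>charts M. cdom M i) = topspace (mtop M) \<and>
     (\<forall>i\<in>charts M. openin (mtop M) (cdom M i) \<and> open (cimage M i) \<and>
        homeomorphic_map (subtopology (mtop M) (cdom M i)) (top_of_set (cimage M i)) (coord M i)) \<and>
     (\<forall>i\<in>charts M. \<forall>j\<in>charts M.
        smooth_on (coord M i ` (cdom M i \<inter> cdom M j)) (coord M j \<circ> param M i))"

definition smooth_function :: "('i, 'a, 'm::finite) atlas \<Rightarrow> ('a \<Rightarrow> real) \<Rightarrow> bool" where
  "smooth_function M u \<longleftrightarrow> (\<forall>i\<in>charts M. smooth_on (cimage M i) (u \<circ> param M i))"

definition open_submanifold :: "(real^'n) set \<Rightarrow> (unit, real^'n, 'n::finite) atlas" where
  "open_submanifold U = \<lparr>mtop = top_of_set U, charts = UNIV, cdom = (\<lambda>_. U), coord = (\<lambda>_ x. x)\<rparr>"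

definition join :: "real^'n \<Rightarrow> real^'m \<Rightarrow> real^('n::finite + 'm::finite)" where
  "join x y = (\<chi> k. case k of Inl i \<Rightarrow> x $ i | Inr j \<Rightarrow> y $ j)"

definition product_manifold ::
  "('i, 'a, 'n::finite) atlas \<Rightarrow> ('j, 'b, 'm::finite) atlas \<Rightarrow> ('i \<times> 'j, 'a \<times> 'b, 'n + 'm) atlas" where
  "product_manifold M N =
     \<lparr>mtop = prod_topology (mtop M) (mtop N),
      charts = charts M \<times> charts N,
      cdom = (\<lambda>(i, j). cdom M i \<times> cdom N j),
      coord = (\<lambda>(i, j) (p, q). join (coord M i p) (coord N j q))\<rparr>"


section \<open>Semi-Riemannian metrics\<close>

text \<open>A (0,2)-tensor field \<open>g\<close> is represented by its component matrices: \<open>g i p\<close> is the matrix of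
  the bilinear form at the point \<open>p\<close> with respect to the coordinate frame of the chart \<open>i\<close>.
  Component matrices in different charts are related by the tensor transformation law, in which
  \<open>jacobian M i j p\<close> is the Jacobian matrix at \<open>p\<close> of the change from the coordinates \<open>i\<close> to
  the coordinates \<open>j\<close>.\<close>

type_synonym ('i, 'a, 'm) tensor2 = "'i \<Rightarrow> 'a \<Rightarrow> real^'m^'m"

definition jacobian :: "('i, 'a, 'm::finite) atlas \<Rightarrow> 'i \<Rightarrow> 'i \<Rightarrow> 'a \<Rightarrow> real^'m^'m" where
  "jacobian M i j p = matrix (frechet_derivative (coord M j \<circ> param M i) (at (coord M i p)))"

definition smooth_tensor2 :: "('i, 'a, 'm::finite) atlas \<Rightarrow> ('i, 'a, 'm) tensor2 \<Rightarrow> bool" where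
  "smooth_tensor2 M g \<longleftrightarrow>
     (\<forall>i\<in>charts M. smooth_on (cimage M i) (g i \<circ> param M i)) \<and>
     (\<forall>i\<in>charts M. \<forall>j\<in>charts M. \<forall>p\<in>cdom M i \<inter> cdom M j.
        g i p = transpose (jacobian M i j p) ** g j p ** jacobian M i j p)"

definition diag_matrix :: "real^'m \<Rightarrow> real^'m^'m" where
  "diag_matrix e = (\<chi> i j. if i = j then e $ i else 0)"

text \<open>The columns of \<open>P\<close> form an orthonormal basis for the symmetric bilinear form \<open>A\<close>, and exactly
  \<open>\<nu>\<close> of them are timelike; by Sylvester's law of inertia \<open>\<nu>\<close> depends only on \<open>A\<close>.\<close>

definition has_index :: "real^'m^'m \<Rightarrow> nat \<Rightarrow> bool" where
  "has_index A \<nu> \<longleftrightarrow>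
     (\<exists>(P :: real^'m^'m) e. invertible P \<and> (\<forall>i. e $ i = 1 \<or> e $ i = -1) \<and>
        transpose P ** A ** P = diag_matrix e \<and> card {i. e $ i = -1} = \<nu>)"

definition semi_riemannian_metric :: "('i, 'a, 'm::finite) atlas \<Rightarrow> ('i, 'a, 'm) tensor2 \<Rightarrow> bool" where
  "semi_riemannian_metric M g \<longleftrightarrow>
     smooth_tensor2 M g \<and>
     (\<forall>i\<in>charts M. \<forall>p\<in>cdom M i. transpose (g i p) = g i p \<and> invertible (g i p)) \<and>
     (\<exists>\<nu>. \<forall>i\<in>charts M. \<forall>p\<in>cdom M i. has_index (g i p) \<nu>)"

definition semi_riemannian_manifold :: "('i, 'a, 'm::finite) atlas \<Rightarrow> ('i, 'a, 'm) tensor2 \<Rightarrow> bool" where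
  "semi_riemannian_manifold M g \<longleftrightarrow> smooth_manifold M \<and> semi_riemannian_metric M g"


section \<open>Curvature and Hessian in local coordinates\<close>

text \<open>Here \<open>G\<close> is the matrix of metric components as a function of the coordinates.\<close>

definition christoffel :: "(real^'m::finite \<Rightarrow> real^'m^'m) \<Rightarrow> 'm \<Rightarrow> 'm \<Rightarrow> 'm \<Rightarrow> real^'m \<Rightarrow> real" where
  "christoffel G k i j y = (1/2) * (\<Sum>l\<in>UNIV. matrix_inv (G y) $ k $ l *
     (pd i (\<lambda>z. G z $ j $ l) y + pd j (\<lambda>z. G z $ i $ l) y - pd l (\<lambda>z. G z $ i $ j) y))"

definition ricci :: "(real^'m::finite \<Rightarrow> real^'m^'m) \<Rightarrow> 'm \<Rightarrow> 'm \<Rightarrow> real^'m \<Rightarrow> real" where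
  "ricci G i j y =
     (\<Sum>k\<in>UNIV. pd k (christoffel G k i j) y - pd j (christoffel G k i k) y) +
     (\<Sum>k\<in>UNIV. \<Sum>l\<in>UNIV. christoffel G k k l y * christoffel G l i j y
                             - christoffel G k j l y * christoffel G l i k y)"

definition scalar_curv :: "(real^'m::finite \<Rightarrow> real^'m^'m) \<Rightarrow> real^'m \<Rightarrow> real" where
  "scalar_curv G y = (\<Sum>i\<in>UNIV. \<Sum>j\<in>UNIV. matrix_inv (G y) $ i $ j * ricci G i j y)"

definition hess :: "(real^'m::finite \<Rightarrow> real^'m^'m) \<Rightarrow> (real^'m \<Rightarrow> real) \<Rightarrow> real^'m \<Rightarrow> real^'m^'m" where
  "hess G U y = (\<chi> i j. pd i (pd j U) y - (\<Sum>k\<in>UNIV. christoffel G k i j y * pd k U y))"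

text \<open>The same objects on a manifold, at the point \<open>p\<close> and computed in the chart \<open>i\<close>. The scalar
  curvature is independent of the chart and the Hessian is a (0,2)-tensor field, so equations
  between them are stated in every chart.\<close>

definition scalar_curvature ::
  "('i, 'a, 'm::finite) atlas \<Rightarrow> ('i, 'a, 'm) tensor2 \<Rightarrow> 'i \<Rightarrow> 'a \<Rightarrow> real" where
  "scalar_curvature M g i p = scalar_curv (g i \<circ> param M i) (coord M i p)"

definition Hessian ::
  "('i, 'a, 'm::finite) atlas \<Rightarrow> ('i, 'a, 'm) tensor2 \<Rightarrow> ('a \<Rightarrow> real) \<Rightarrow> ('i, 'a, 'm) tensor2" where
  "Hessian M g u i p = hess (g i \<circ> param M i) (u \<circ> param M i) (coord M i p)"

definition constant_scalar_curvature ::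
  "('i, 'a, 'm::finite) atlas \<Rightarrow> ('i, 'a, 'm) tensor2 \<Rightarrow> real \<Rightarrow> bool" where
  "constant_scalar_curvature M g c \<longleftrightarrow>
     (\<forall>i\<in>charts M. \<forall>p\<in>cdom M i. scalar_curvature M g i p = c)"

definition gradient_Yamabe_soliton ::
  "('i, 'a, 'm::finite) atlas \<Rightarrow> ('i, 'a, 'm) tensor2 \<Rightarrow> ('a \<Rightarrow> real) \<Rightarrow> real \<Rightarrow> bool" where
  "gradient_Yamabe_soliton M g u \<rho> \<longleftrightarrow>
     semi_riemannian_manifold M g \<and> smooth_function M u \<and>
     (\<forall>i\<in>charts M. \<forall>p\<in>cdom M i.
        (scalar_curvature M g i p - \<rho>) *\<^sub>R g i p = Hessian M g u i p)"

definition steady_gradient_Yamabe_soliton ::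
  "('i, 'a, 'm::finite) atlas \<Rightarrow> ('i, 'a, 'm) tensor2 \<Rightarrow> ('a \<Rightarrow> real) \<Rightarrow> bool" where
  "steady_gradient_Yamabe_soliton M g u \<longleftrightarrow> gradient_Yamabe_soliton M g u 0"


section \<open>Warped products\<close>

definition block_diag :: "real^'n^'n \<Rightarrow> real^'m^'m \<Rightarrow> real^('n::finite + 'm::finite)^('n + 'm)" where
  "block_diag A B = (\<chi> k l. case (k, l) of
       (Inl i, Inl j) \<Rightarrow> A $ i $ j
     | (Inr i, Inr j) \<Rightarrow> B $ i $ j
     | _ \<Rightarrow> 0)"

text \<open>The metric \<open>g\<^sub>B + w\<^sup>2 g\<^sub>F\<close> on \<open>B \<times> F\<close> (pullbacks along the projections understood), in the
  charts of \<^const>\<open>product_manifold\<close>.\<close>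

definition warped_metric ::
  "('i, 'a, 'n::finite) tensor2 \<Rightarrow> ('a \<Rightarrow> real) \<Rightarrow> ('j, 'b, 'm::finite) tensor2
     \<Rightarrow> ('i \<times> 'j, 'a \<times> 'b, 'n + 'm) tensor2" where
  "warped_metric gB w gF = (\<lambda>(i, j) (p, q). block_diag (gB i p) ((w p)\<^sup>2 *\<^sub>R gF j q))"

end

theory Submission
  imports Defs
begin

text \<open>
  Why the theorem holds. The functions \<open>\<phi>\<close>, \<open>f\<close> and \<open>h\<close> all depend on the linear form \<open>\<xi>\<close> alone,
  so their gradients are multiples of \<open>\<alpha>\<close> (with the index raised), and \<open>\<alpha>\<close> is null: the
  inner product of any two of these gradients vanishes, and so do all their Laplacians. In the usual
  formulas for conformal changes and warped products, the scalar curvature of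
  \<open>\<delta> / \<phi>\<^sup>2 + f\<^sup>2 g\<^sub>F\<close> is \<open>\<lambda>\<^sub>F / f\<^sup>2\<close> plus terms that contain a Laplacian or an inner
  product of gradients. Hence it is \<open>\<lambda>\<^sub>F / f\<^sup>2 = 0\<close> (lemma \<open>scalar_curv_G\<close>), and the steady
  soliton equation says that the Hessian of \<open>h \<circ> \<xi>\<close> vanishes.

  The only components of this Hessian that survive the null condition are those along the base,
  \<open>(h'' + 2 (\<phi>' / \<phi>) h') \<alpha>\<^sub>i \<alpha>\<^sub>j\<close> (lemma \<open>hess_G\<close>). As some \<open>\<alpha>\<^sub>i\<close> is nonzero and
  \<open>\<xi>\<close> attains every value in the interval, the soliton equation is equivalent to
  \<open>h'' + 2 (\<phi>' / \<phi>) h' = 0\<close>, that is \<open>(h' \<phi>\<^sup>2)' = 0\<close> (lemma \<open>soliton_ode_iff\<close>).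

  The curvature is computed from the Christoffel symbols in product coordinates, in the locale
  \<open>null_warped_coordinates\<close>. Vectors indexed by a sum type split into a base part and a fibre part,
  and the metric is block diagonal, so every contraction becomes a sum over the base indices plus a
  sum over the fibre indices. The congruence rules \<open>scalar_curv_cong\<close> and \<open>hess_cong\<close> transfer the
  result to the charts of the product manifold.

  A soliton is by definition a semi-Riemannian manifold with a smooth potential, so it must also be
  shown that products of manifolds are manifolds (\<open>smooth_manifold_product\<close>) and that warped
  metrics on them are semi-Riemannian (\<open>semi_riemannian_metric_warped\<close>); this rests on closure
  properties of smooth functions under linear substitutions, products and reciprocals.
\<close>

section \<open>Splitting coordinates and block diagonal matrices\<close>

definition base_part :: "real^('n::finite + 'd::finite) \<Rightarrow> real^'n" where
  "base_part z = (\<chi> i. z $ Inl i)"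

definition fibre_part :: "real^('n::finite + 'd::finite) \<Rightarrow> real^'d" where
  "fibre_part z = (\<chi> j. z $ Inr j)"

lemma split_nth [simp]:
  "join x y $ Inl i = x $ i" "join x y $ Inr j = y $ j"
  "base_part z $ i = z $ Inl i" "fibre_part z $ j = z $ Inr j"
  by (simp_all add: join_def base_part_def fibre_part_def)

lemma vec_eq_sum_type_iff:
  fixes z w :: "'a^('n::finite + 'd::finite)"
  shows "z = w \<longleftrightarrow> (\<forall>i. z $ Inl i = w $ Inl i) \<and> (\<forall>j. z $ Inr j = w $ Inr j)"
  unfolding vec_eq_iff by (auto simp: split_sum_all)

lemma split_join [simp]:
  "base_part (join x y) = x" "fibre_part (join x y) = y" "join (base_part z) (fibre_part z) = z"
  by (simp_all add: vec_eq_iff split_sum_all)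

lemma join_eq_iff [simp]: "join x y = join x' y' \<longleftrightarrow> x = x' \<and> y = y'"
  by (metis split_join(1,2))

lemma split_axis [simp]:
  "base_part (axis (Inl i) 1) = axis i 1" "base_part (axis (Inr j) 1) = 0"
  "fibre_part (axis (Inl i) 1) = 0" "fibre_part (axis (Inr j) 1) = axis j 1"
  by (simp_all add: vec_eq_iff axis_def)

lemma linear_base_part [intro!, simp]: "linear base_part"
  and linear_fibre_part [intro!, simp]: "linear fibre_part"
  by (simp_all add: linear_iff vec_eq_iff)

lemma linear_join_left [intro!, simp]: "linear (\<lambda>x. join x 0)"
  and linear_join_right [intro!, simp]: "linear (\<lambda>y. join 0 y)"
  by (simp_all add: linear_iff vec_eq_sum_type_iff)

lemma join_eq_add: "join x y = join x 0 + join 0 y"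
  by (simp add: vec_eq_sum_type_iff)

lemma bounded_linear_split:
  "bounded_linear base_part" "bounded_linear fibre_part"
  "bounded_linear (\<lambda>x. join x 0)" "bounded_linear (\<lambda>y. join 0 y)"
  by (simp_all flip: linear_conv_bounded_linear)

lemma continuous_on_join [continuous_intros]:
  assumes "continuous_on S f" "continuous_on S g"
  shows "continuous_on S (\<lambda>x. join (f x) (g x))"
proof -
  have "continuous_on S (\<lambda>x. join (f x) 0 + join 0 (g x))"
    using bounded_linear.continuous_on[OF bounded_linear_split(3) assms(1)]
      bounded_linear.continuous_on[OF bounded_linear_split(4) assms(2)]
    by (rule continuous_on_add)
  then show ?thesis
    by (simp flip: join_eq_add)
qed

lemmas continuous_on_split [continuous_intros] =
  bounded_linear_split(1,2)[THEN bounded_linear.continuous_on]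

lemma has_derivative_join [derivative_intros]:
  assumes "(f has_derivative f') F" "(g has_derivative g') F"
  shows "((\<lambda>x. join (f x) (g x)) has_derivative (\<lambda>v. join (f' v) (g' v))) F"
proof -
  have "((\<lambda>x. join (f x) 0 + join 0 (g x)) has_derivative (\<lambda>v. join (f' v) 0 + join 0 (g' v))) F"
    using bounded_linear.has_derivative[OF bounded_linear_split(3) assms(1)]
      bounded_linear.has_derivative[OF bounded_linear_split(4) assms(2)]
    by (rule has_derivative_add)
  then show ?thesis
    by (simp flip: join_eq_add)
qed

lemmas has_derivative_split [derivative_intros] =
  bounded_linear_split(1,2)[THEN bounded_linear.has_derivative]

definition split_product :: "(real^'n) set \<Rightarrow> (real^'d) set \<Rightarrow> (real^('n::finite + 'd::finite)) set" where
  "split_product A B = {z. base_part z \<in> A \<and> fibre_part z \<in> B}"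

lemma open_split_product: "open A \<Longrightarrow> open B \<Longrightarrow> open (split_product A B)"
proof -
  assume "open A" "open B"
  then have "open (base_part -` A \<inter> fibre_part -` B)"
    by (intro open_Int open_vimage continuous_on_split[OF continuous_on_id])
  then show ?thesis
    by (simp add: split_product_def vimage_def Collect_conj_eq)
qed

lemma image_join_Times: "(\<lambda>(p, q). join (c p) (e q)) ` (A \<times> B) = split_product (c ` A) (e ` B)"
proof -
  have "z \<in> (\<lambda>(p, q). join (c p) (e q)) ` (A \<times> B)"
    if "base_part z = c p" "fibre_part z = e q" "p \<in> A" "q \<in> B" for z p q
    using that split_join(3)[of z] by (intro image_eqI[of _ _ "(p, q)"]) auto
  then show ?thesis
    by (auto simp: split_product_def image_iff)
qed

lemma sum_sum_type:
  fixes f :: "'n::finite + 'd::finite \<Rightarrow> 'c::comm_monoid_add"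
  shows "sum f UNIV = (\<Sum>i\<in>UNIV. f (Inl i)) + (\<Sum>j\<in>UNIV. f (Inr j))"
  using sum.Plus[of UNIV UNIV f] by (simp add: o_def)

lemma block_diag_nth [simp]:
  "block_diag A B $ Inl i $ Inl j = A $ i $ j" "block_diag A B $ Inr k $ Inr l = B $ k $ l"
  "block_diag A B $ Inl i $ Inr l = 0" "block_diag A B $ Inr k $ Inl j = 0"
  by (simp_all add: block_diag_def)

lemma block_diag_mult: "block_diag A B ** block_diag A' B' = block_diag (A ** A') (B ** B')"
  by (simp add: vec_eq_sum_type_iff matrix_matrix_mult_def sum_sum_type)

lemma block_diag_transpose: "transpose (block_diag A B) = block_diag (transpose A) (transpose B)"
  by (simp add: vec_eq_sum_type_iff transpose_def)

lemma block_diag_one: "block_diag (mat 1) (mat 1) = mat 1"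
  by (simp add: vec_eq_sum_type_iff mat_def)

lemma matrix_inv_unique:
  fixes A B :: "'a::field^'n::finite^'n"
  assumes "A ** B = mat 1"
  shows "matrix_inv A = B" "invertible A"
proof -
  show "invertible A"
    using assms matrix_left_right_inverse invertible_def by blast
  then have "matrix_inv A ** A = mat 1"
    unfolding matrix_inv_def invertible_def by (metis (mono_tags, lifting) someI_ex)
  then show "matrix_inv A = B"
    by (metis assms matrix_mul_assoc matrix_mul_lid matrix_mul_rid)
qed

lemma matrix_inv_works:
  fixes A :: "'a::field^'n::finite^'n"
  assumes "invertible A"
  shows "A ** matrix_inv A = mat 1"
  using assms matrix_inv_unique(1) unfolding invertible_def by metis

lemma block_diag_inverse:
  assumes "invertible A" "invertible B"
  shows "matrix_inv (block_diag A B) = block_diag (matrix_inv A) (matrix_inv B)"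
    "invertible (block_diag A B)"
proof -
  have "block_diag A B ** block_diag (matrix_inv A) (matrix_inv B) = mat 1"
    using assms by (simp add: block_diag_mult matrix_inv_works block_diag_one)
  then show "matrix_inv (block_diag A B) = block_diag (matrix_inv A) (matrix_inv B)"
    "invertible (block_diag A B)"
    by (rule matrix_inv_unique)+
qed

lemma matrix_inv_scaleR:
  fixes A :: "real^'n::finite^'n"
  assumes "c \<noteq> 0" "invertible A"
  shows "matrix_inv (c *\<^sub>R A) = (1 / c) *\<^sub>R matrix_inv A" "invertible (c *\<^sub>R A)"
proof -
  have "(c *\<^sub>R A) ** ((1 / c) *\<^sub>R matrix_inv A) = mat 1"
    unfolding matrix_inv_works[OF assms(2), symmetric]
    using assms(1) by (simp add: vec_eq_iff matrix_matrix_mult_def)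
  then show "matrix_inv (c *\<^sub>R A) = (1 / c) *\<^sub>R matrix_inv A" "invertible (c *\<^sub>R A)"
    by (rule matrix_inv_unique)+
qed

lemma diag_matrix_nth: "diag_matrix e $ i $ j = (if i = j then e $ i else 0)"
  by (simp add: diag_matrix_def)

lemma sum_diag_matrix: "(\<Sum>k\<in>UNIV. diag_matrix e $ i $ k * v k) = e $ i * v i"
proof -
  have "(\<Sum>k\<in>UNIV. diag_matrix e $ i $ k * v k) = (\<Sum>k\<in>UNIV. if k = i then e $ i * v i else 0)"
    by (intro sum.cong) (auto simp: diag_matrix_nth)
  then show ?thesis by simp
qed

lemma diag_matrix_sign_inverse:
  assumes "\<And>i. e $ i = 1 \<or> e $ i = -1"
  shows "matrix_inv (diag_matrix e) = diag_matrix e" "invertible (diag_matrix e)"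
proof -
  have "e $ i * e $ i = 1" for i
    using assms[of i] by auto
  then have "diag_matrix e ** diag_matrix e = mat 1"
    unfolding vec_eq_iff matrix_matrix_mult_def
    by (simp add: sum_diag_matrix mat_def) (simp add: diag_matrix_nth)
  then show "matrix_inv (diag_matrix e) = diag_matrix e" "invertible (diag_matrix e)"
    by (rule matrix_inv_unique)+
qed

section \<open>Calculus of smooth functions\<close>

declare Ck_on.simps(2) [simp del]

lemma Ck_on_imp_continuous_on: "Ck_on k S f \<Longrightarrow> continuous_on S f"
  by (cases k)
    (auto simp: Ck_on.simps(2) intro!: continuous_at_imp_continuous_on differentiable_imp_continuous_within)

lemma Ck_on_Suc_imp: "Ck_on (Suc k) S f \<Longrightarrow> Ck_on k S f"
proof (induction k arbitrary: f)
  case 0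
  then show ?case
    using Ck_on_imp_continuous_on by auto
next
  case (Suc k)
  then show ?case
    unfolding Ck_on.simps(2) by blast
qed

lemma Ck_on_cong:
  assumes "open S" "\<And>x. x \<in> S \<Longrightarrow> f x = g x" "Ck_on k S f"
  shows "Ck_on k S g"
  using assms(2,3)
proof (induction k arbitrary: f g)
  case 0
  then show ?case by (metis Ck_on.simps(1) continuous_on_cong)
next
  case (Suc k)
  have d: "f differentiable at x" if "x \<in> S" for x
    using Suc.prems(2) that by (simp add: Ck_on.simps(2))
  have "g differentiable at x" if "x \<in> S" for x
    using has_derivative_transform_within_open[OF _ assms(1) that, of f _ UNIV g] d[OF that]
      Suc.prems(1) unfolding differentiable_def by blast
  moreover have "Ck_on k S (\<lambda>x. frechet_derivative g (at x) v)" for v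
  proof (rule Suc.IH)
    show "Ck_on k S (\<lambda>x. frechet_derivative f (at x) v)"
      using Suc.prems(2) by (simp add: Ck_on.simps(2))
    show "frechet_derivative f (at x) v = frechet_derivative g (at x) v" if "x \<in> S" for x
      using frechet_derivative_transform_within_open[OF d[OF that] assms(1) that Suc.prems(1)]
      by simp
  qed
  ultimately show ?case by (simp add: Ck_on.simps(2))
qed

text \<open>This rule drives all closure properties below by induction on \<open>k\<close>: a rule of calculus
  gives the derivative, and the expression it produces is \<open>C\<^sup>k\<close> by the induction hypothesis.
  Openness of \<open>S\<close> makes derivatives depend only on the values in \<open>S\<close>.\<close>

lemma Ck_on_SucI:
  assumes "open S" "\<And>x. x \<in> S \<Longrightarrow> (f has_derivative f' x) (at x)"
    "\<And>v. Ck_on k S (\<lambda>x. f' x v)"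
  shows "Ck_on (Suc k) S f"
proof -
  have "Ck_on k S (\<lambda>x. frechet_derivative f (at x) v)" for v
    by (rule Ck_on_cong[OF assms(1) _ assms(3)[of v]])
      (simp add: frechet_derivative_at[OF assms(2), symmetric])
  then show ?thesis
    using assms(2) unfolding Ck_on.simps(2) differentiable_def by blast
qed

lemma Ck_on_SucD:
  assumes "Ck_on (Suc k) S f"
  shows "x \<in> S \<Longrightarrow> (f has_derivative frechet_derivative f (at x)) (at x)"
    "Ck_on k S (\<lambda>x. frechet_derivative f (at x) v)"
  using assms frechet_derivative_works by (auto simp: Ck_on.simps(2))

lemma Ck_on_const: "open S \<Longrightarrow> Ck_on k S (\<lambda>x. c)"
proof (induction k arbitrary: c)
  case (Suc k)
  then show ?case
    by (intro Ck_on_SucI[where f' = "\<lambda>x v. 0"]) auto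
qed auto

lemma Ck_on_linear:
  fixes L :: "'a::euclidean_space \<Rightarrow> 'b::real_normed_vector"
  assumes "linear L" "open S"
  shows "Ck_on k S L"
proof (cases k)
  case 0
  then show ?thesis using assms by (auto intro: linear_continuous_on simp flip: linear_conv_bounded_linear)
next
  case (Suc m)
  then show ?thesis
    using assms
    by (auto intro!: Ck_on_SucI[where f' = "\<lambda>_. L"] Ck_on_const linear_imp_has_derivative)
qed

lemma Ck_on_add:
  assumes "open S" "Ck_on k S f" "Ck_on k S g"
  shows "Ck_on k S (\<lambda>x. f x + g x)"
  using assms(2,3)
proof (induction k arbitrary: f g)
  case 0
  then show ?case by (auto intro: continuous_intros)
next
  case (Suc k)
  note f = Ck_on_SucD[OF Suc.prems(1)] and g = Ck_on_SucD[OF Suc.prems(2)]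
  show ?case
    by (rule Ck_on_SucI[OF assms(1) has_derivative_add[OF f(1) g(1)] Suc.IH[OF f(2) g(2)]])
qed

lemma Ck_on_bounded_linear:
  assumes "open S" "bounded_linear L" "Ck_on k S f"
  shows "Ck_on k S (\<lambda>x. L (f x))"
  using assms(3)
proof (induction k arbitrary: f)
  case 0
  then show ?case using bounded_linear.continuous_on[OF assms(2)] by auto
next
  case (Suc k)
  note f = Ck_on_SucD[OF Suc.prems]
  show ?case
    by (rule Ck_on_SucI[OF assms(1) bounded_linear.has_derivative[OF assms(2) f(1)] Suc.IH[OF f(2)]])
qed

lemma Ck_on_scaleR:
  fixes f :: "'a::euclidean_space \<Rightarrow> real"
  assumes "open S" "Ck_on k S f" "Ck_on k S g"
  shows "Ck_on k S (\<lambda>x. f x *\<^sub>R g x)"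
  using assms(2,3)
proof (induction k arbitrary: f g)
  case 0
  then show ?case by (auto intro: continuous_intros)
next
  case (Suc k)
  note f = Ck_on_SucD[OF Suc.prems(1)] and g = Ck_on_SucD[OF Suc.prems(2)]
  show ?case
    by (rule Ck_on_SucI[OF assms(1) has_derivative_scaleR[OF f(1) g(1)]
          Ck_on_add[OF assms(1) Suc.IH[OF Ck_on_Suc_imp[OF Suc.prems(1)] g(2)]
            Suc.IH[OF f(2) Ck_on_Suc_imp[OF Suc.prems(2)]]]])
qed

lemma Ck_on_inverse:
  fixes f :: "'a::euclidean_space \<Rightarrow> real"
  assumes "open S" "\<And>x. x \<in> S \<Longrightarrow> f x \<noteq> 0" "Ck_on k S f"
  shows "Ck_on k S (\<lambda>x. 1 / f x)"
  using assms(3)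
proof (induction k)
  case 0
  then show ?case using assms(2) by (auto intro!: continuous_intros)
next
  case (Suc k)
  have 1: "Ck_on k S (\<lambda>x. 1 / f x)"
    using Suc Ck_on_Suc_imp by blast
  have 2: "Ck_on k S (\<lambda>x. (- 1) *\<^sub>R ((1 / f x) *\<^sub>R (1 / f x) *\<^sub>R frechet_derivative f (at x) v))" for v
    by (rule Ck_on_scaleR[OF assms(1) Ck_on_const[OF assms(1)]
          Ck_on_scaleR[OF assms(1) 1 Ck_on_scaleR[OF assms(1) 1 Ck_on_SucD(2)[OF Suc.prems]]]])
  show ?case
  proof (rule Ck_on_SucI[OF assms(1) _ 2])
    fix x assume "x \<in> S"
    then show "((\<lambda>x. 1 / f x) has_derivative (\<lambda>v. (- 1) *\<^sub>R ((1 / f x) *\<^sub>R (1 / f x) *\<^sub>R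
        frechet_derivative f (at x) v))) (at x)"
      using assms(2)
      by (auto intro!: derivative_eq_intros Ck_on_SucD(1)[OF Suc.prems]
          simp: divide_simps)
  qed
qed

lemma Ck_on_compose_linear:
  fixes L :: "'a::euclidean_space \<Rightarrow> 'b::euclidean_space"
  assumes "linear L" "open T" "open S" "L ` T \<subseteq> S" "Ck_on k S f"
  shows "Ck_on k T (\<lambda>x. f (L x))"
  using assms(5)
proof (induction k arbitrary: f)
  case 0
  have "continuous_on T L"
    using assms(1) by (auto intro: linear_continuous_on simp flip: linear_conv_bounded_linear)
  then show ?case
    using 0 continuous_on_compose2 assms(4) by auto
next
  case (Suc k)
  show ?case
  proof (rule Ck_on_SucI[OF assms(2)])
    show "((\<lambda>x. f (L x)) has_derivative (\<lambda>v. frechet_derivative f (at (L x)) (L v))) (at x)"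
      if "x \<in> T" for x
      using has_derivative_compose[OF linear_imp_has_derivative[OF assms(1)]
          Ck_on_SucD(1)[OF Suc.prems]] that assms(4) by blast
    show "Ck_on k T (\<lambda>x. frechet_derivative f (at (L x)) (L v))" for v
      by (rule Suc.IH[OF Ck_on_SucD(2)[OF Suc.prems]])
  qed
qed

lemma smooth_on_cong: "\<lbrakk>open S; \<And>x. x \<in> S \<Longrightarrow> f x = g x; smooth_on S f\<rbrakk> \<Longrightarrow> smooth_on S g"
  unfolding smooth_on_def using Ck_on_cong[of S f g] by simp

lemma smooth_on_const: "open S \<Longrightarrow> smooth_on S (\<lambda>x. c)"
  unfolding smooth_on_def by (simp add: Ck_on_const)

lemma smooth_on_linear: "\<lbrakk>open S; linear L\<rbrakk> \<Longrightarrow> smooth_on S L"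
  unfolding smooth_on_def by (simp add: Ck_on_linear)

lemma smooth_on_add:
  "\<lbrakk>open S; smooth_on S f; smooth_on S g\<rbrakk> \<Longrightarrow> smooth_on S (\<lambda>x. f x + g x)"
  unfolding smooth_on_def by (simp add: Ck_on_add)

lemma smooth_on_bounded_linear:
  "\<lbrakk>open S; bounded_linear L; smooth_on S f\<rbrakk> \<Longrightarrow> smooth_on S (\<lambda>x. L (f x))"
  unfolding smooth_on_def by (simp add: Ck_on_bounded_linear)

lemma smooth_on_scaleR:
  "\<lbrakk>open S; smooth_on S r; smooth_on S f\<rbrakk> \<Longrightarrow> smooth_on S (\<lambda>x. (r x :: real) *\<^sub>R f x)"
  unfolding smooth_on_def by (simp add: Ck_on_scaleR)

lemma smooth_on_inverse:
  "\<lbrakk>open S; \<And>x. x \<in> S \<Longrightarrow> r x \<noteq> 0; smooth_on S r\<rbrakk> \<Longrightarrow> smooth_on S (\<lambda>x. 1 / r x :: real)"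
  unfolding smooth_on_def by (simp add: Ck_on_inverse)

text \<open>Composition with linear maps is the only chain rule for smooth functions that is needed: the
  potential and the warping function enter through the linear form \<open>\<xi>\<close>, and the data of the two
  factors of a product through the projections onto their coordinates.\<close>

lemma smooth_on_compose_linear:
  fixes L :: "'a::euclidean_space \<Rightarrow> 'b::euclidean_space"
  assumes "open T" "linear L" "open S" "L ` T \<subseteq> S" "smooth_on S f"
  shows "smooth_on T (\<lambda>x. f (L x))"
  using assms Ck_on_compose_linear unfolding smooth_on_def by blast

lemma smooth_on_has_derivative:
  "smooth_on S f \<Longrightarrow> x \<in> S \<Longrightarrow> (f has_derivative frechet_derivative f (at x)) (at x)"
  unfolding smooth_on_def using Ck_on_SucD(1) by blast

lemma smooth_on_frechet_derivative:
  "smooth_on S f \<Longrightarrow> smooth_on S (\<lambda>x. frechet_derivative f (at x) v)"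
  unfolding smooth_on_def using Ck_on_SucD(2) by blast

lemma smooth_on_deriv:
  fixes f :: "real \<Rightarrow> real"
  assumes "open S" "smooth_on S f"
  shows "\<And>x. x \<in> S \<Longrightarrow> (f has_real_derivative deriv f x) (at x)" "smooth_on S (deriv f)"
proof -
  have *: "(f has_real_derivative frechet_derivative f (at x) 1) (at x)" if "x \<in> S" for x
  proof -
    have d: "(f has_derivative frechet_derivative f (at x)) (at x)"
      using smooth_on_has_derivative[OF assms(2) that] .
    have "v * frechet_derivative f (at x) 1 = frechet_derivative f (at x) v" for v
      using linear_cmul[OF has_derivative_linear[OF d], of v 1] by simp
    then show ?thesis
      by (rule has_derivative_imp_has_field_derivative[OF d])
  qed
  then show "(f has_real_derivative deriv f x) (at x)" if "x \<in> S" for x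
    using * that by (subst DERIV_imp_deriv) blast+
  show "smooth_on S (deriv f)"
    by (rule smooth_on_cong[OF assms(1) _ smooth_on_frechet_derivative[OF assms(2)]])
      (use * DERIV_imp_deriv in fastforce)
qed

section \<open>Products of manifolds\<close>

lemma smooth_on_join:
  assumes "open S" "smooth_on S f" "smooth_on S g"
  shows "smooth_on S (\<lambda>x. join (f x) (g x))"
proof -
  have "smooth_on S (\<lambda>x. join (f x) 0 + join 0 (g x))"
    by (rule smooth_on_add[OF assms(1)
          smooth_on_bounded_linear[OF assms(1) bounded_linear_split(3) assms(2)]
          smooth_on_bounded_linear[OF assms(1) bounded_linear_split(4) assms(3)]])
  then show ?thesis
    by (simp flip: join_eq_add)
qed

lemma smooth_on_split:
  assumes "open A" "open B"
  shows "smooth_on A f \<Longrightarrow> smooth_on (split_product A B) (\<lambda>z. f (base_part z))"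
    and "smooth_on B g \<Longrightarrow> smooth_on (split_product A B) (\<lambda>z. g (fibre_part z))"
proof -
  have *: "base_part ` split_product A B \<subseteq> A" "fibre_part ` split_product A B \<subseteq> B"
    by (auto simp: split_product_def)
  show "smooth_on (split_product A B) (\<lambda>z. f (base_part z))" if "smooth_on A f"
    by (rule smooth_on_compose_linear[OF open_split_product[OF assms] linear_base_part assms(1) *(1) that])
  show "smooth_on (split_product A B) (\<lambda>z. g (fibre_part z))" if "smooth_on B g"
    by (rule smooth_on_compose_linear[OF open_split_product[OF assms] linear_fibre_part assms(2) *(2) that])
qed

context
  fixes M :: "('i, 'a, 'm::finite) atlas"
  assumes M: "smooth_manifold M"
begin

lemma chart_homeomorphism:
  "i \<in> charts M \<Longrightarrow>
     homeomorphic_map (subtopology (mtop M) (cdom M i)) (top_of_set (cimage M i)) (coord M i)"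
  using M unfolding smooth_manifold_def by blast

lemma openin_cdom: "i \<in> charts M \<Longrightarrow> openin (mtop M) (cdom M i)"
  and open_cimage: "i \<in> charts M \<Longrightarrow> open (cimage M i)"
  using M unfolding smooth_manifold_def by blast+

lemma inj_on_coord: "i \<in> charts M \<Longrightarrow> inj_on (coord M i) (cdom M i)"
  using homeomorphic_imp_injective_map[OF chart_homeomorphism] openin_subset[OF openin_cdom]
  by (simp add: Int_absorb1)

lemma param_in_cdom: "y \<in> cimage M i \<Longrightarrow> param M i y \<in> cdom M i"
  by (simp add: param_def cimage_def inv_into_into)

lemma coord_param: "y \<in> cimage M i \<Longrightarrow> coord M i (param M i y) = y"
  by (simp add: param_def cimage_def f_inv_into_f)

lemma open_chart_overlap:
  assumes "i \<in> charts M" "j \<in> charts M"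
  shows "open (coord M i ` (cdom M i \<inter> cdom M j))"
proof -
  have "openin (subtopology (mtop M) (cdom M i)) (cdom M i \<inter> cdom M j)"
    using assms by (simp add: openin_subtopology_Int2 openin_cdom)
  then have "openin (top_of_set (cimage M i)) (coord M i ` (cdom M i \<inter> cdom M j))"
    using homeomorphic_imp_open_map[OF chart_homeomorphism[OF assms(1)]]
    by (simp add: open_map_def)
  then show ?thesis
    using open_cimage[OF assms(1)] openin_open_eq by blast
qed

lemma smooth_transition:
  "i \<in> charts M \<Longrightarrow> j \<in> charts M \<Longrightarrow>
     smooth_on (coord M i ` (cdom M i \<inter> cdom M j)) (coord M j \<circ> param M i)"
  using M unfolding smooth_manifold_def by blast

end

text \<open>Products of members of two countable bases form a countable basis.\<close>

lemma second_countable_prod_topology: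
  assumes "second_countable X" "second_countable Y"
  shows "second_countable (prod_topology X Y)"
proof -
  obtain \<A> where A: "countable \<A>" "\<forall>V\<in>\<A>. openin X V"
    "\<forall>U x. openin X U \<and> x \<in> U \<longrightarrow> (\<exists>V\<in>\<A>. x \<in> V \<and> V \<subseteq> U)"
    using assms(1) unfolding second_countable_def by blast
  obtain \<B> where B: "countable \<B>" "\<forall>V\<in>\<B>. openin Y V"
    "\<forall>U x. openin Y U \<and> x \<in> U \<longrightarrow> (\<exists>V\<in>\<B>. x \<in> V \<and> V \<subseteq> U)"
    using assms(2) unfolding second_countable_def by blast
  let ?C = "(\<lambda>(V, W). V \<times> W) ` (\<A> \<times> \<B>)"
  have base: "\<exists>S\<in>?C. z \<in> S \<and> S \<subseteq> U" if U: "openin (prod_topology X Y) U" "z \<in> U" for U z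
  proof -
    obtain U1 U2 where W: "openin X U1" "openin Y U2" "fst z \<in> U1" "snd z \<in> U2" "U1 \<times> U2 \<subseteq> U"
      using U unfolding openin_prod_topology_alt by (metis prod.collapse)
    obtain V where V: "V \<in> \<A>" "fst z \<in> V" "V \<subseteq> U1"
      using A(3) W(1,3) by blast
    obtain V' where V': "V' \<in> \<B>" "snd z \<in> V'" "V' \<subseteq> U2"
      using B(3) W(2,4) by blast
    have "z \<in> V \<times> V'" "V \<times> V' \<subseteq> U"
      using V V' W(5) by (auto simp: mem_Times_iff)
    moreover have "V \<times> V' \<in> ?C"
      using V(1) V'(1) by (intro image_eqI[of _ _ "(V, V')"]) simp_all
    ultimately show ?thesis
      by (intro bexI[of _ "V \<times> V'"] conjI)
  qed
  have "countable ?C" "\<forall>V\<in>?C. openin (prod_topology X Y) V"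
    using A(1,2) B(1,2) by (auto simp: openin_prod_Times_iff)
  with base show ?thesis
    unfolding second_countable_def by (intro exI[of _ ?C] conjI allI impI) (assumption | blast)+
qed

lemma product_manifold_simps [simp]:
  "mtop (product_manifold M N) = prod_topology (mtop M) (mtop N)"
  "charts (product_manifold M N) = charts M \<times> charts N"
  "cdom (product_manifold M N) (i, j) = cdom M i \<times> cdom N j"
  "coord (product_manifold M N) (i, j) = (\<lambda>(p, q). join (coord M i p) (coord N j q))"
  by (simp_all add: product_manifold_def)

lemma cimage_product [simp]:
  "cimage (product_manifold M N) (i, j) = split_product (cimage M i) (cimage N j)"
  by (simp add: cimage_def image_join_Times)

lemma homeomorphic_map_join:
  assumes "homeomorphic_map X (top_of_set A) c" "homeomorphic_map Y (top_of_set B) e"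
  shows "homeomorphic_map (prod_topology X Y) (top_of_set (split_product A B))
    (\<lambda>(p, q). join (c p) (e q))"
proof -
  have 1: "homeomorphic_map (prod_topology X Y) (prod_topology (top_of_set A) (top_of_set B))
      (\<lambda>(p, q). (c p, e q))"
    using assms unfolding homeomorphic_map_maps by (metis homeomorphic_maps_prod)
  have "homeomorphic_maps (top_of_set (A \<times> B)) (top_of_set (split_product A B))
      (\<lambda>(x, y). join x y) (\<lambda>z. (base_part z, fibre_part z))"
    unfolding homeomorphic_maps_def continuous_map_in_subtopology
    by (auto simp: split_product_def case_prod_unfold intro!: continuous_intros)
  then have "homeomorphic_map (prod_topology (top_of_set A) (top_of_set B))
      (top_of_set (split_product A B)) (\<lambda>(x, y). join x y)"
    unfolding homeomorphic_map_maps by (auto simp flip: subtopology_Times)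
  from homeomorphic_map_compose[OF 1 this] show ?thesis
    by (simp add: o_def case_prod_unfold)
qed

context
  fixes M :: "('i, 'a, 'm::finite) atlas" and N :: "('j, 'b, 'd::finite) atlas"
  assumes M: "smooth_manifold M" and N: "smooth_manifold N"
begin

lemma param_product:
  assumes "i \<in> charts M" "j \<in> charts N" "z \<in> split_product (cimage M i) (cimage N j)"
  shows "param (product_manifold M N) (i, j) z = (param M i (base_part z), param N j (fibre_part z))"
proof -
  let ?p = "param M i (base_part z)" and ?q = "param N j (fibre_part z)"
  have z: "base_part z \<in> cimage M i" "fibre_part z \<in> cimage N j"
    using assms(3) by (auto simp: split_product_def)
  have "inj_on (\<lambda>(p, q). join (coord M i p) (coord N j q)) (cdom M i \<times> cdom N j)"
    using inj_on_coord[OF M assms(1)] inj_on_coord[OF N assms(2)] by (auto simp: inj_on_def)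
  from inv_into_f_f[OF this, of "(?p, ?q)"]
  have "param (product_manifold M N) (i, j) (join (coord M i ?p) (coord N j ?q)) = (?p, ?q)"
    using z by (simp add: param_def[of "product_manifold M N"] param_in_cdom M N)
  then show ?thesis
    using z by (simp add: coord_param M N)
qed

lemma overlap_product:
  "coord (product_manifold M N) (i, j) `
     (cdom (product_manifold M N) (i, j) \<inter> cdom (product_manifold M N) (i', j')) =
   split_product (coord M i ` (cdom M i \<inter> cdom M i')) (coord N j ` (cdom N j \<inter> cdom N j'))"
  by (simp add: Times_Int_Times image_join_Times)

text \<open>Coordinate changes of a product act separately on the two groups of coordinates. This one
  formula gives both smoothness of the product atlas and block diagonal Jacobians.\<close>

lemma transition_product:
  assumes "i \<in> charts M" "j \<in> charts N"
    and "z \<in> split_product (coord M i ` (cdom M i \<inter> cdom M i')) (coord N j ` (cdom N j \<inter> cdom N j'))"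
  shows "(coord (product_manifold M N) (i', j') \<circ> param (product_manifold M N) (i, j)) z =
    join ((coord M i' \<circ> param M i) (base_part z)) ((coord N j' \<circ> param N j) (fibre_part z))"
proof -
  have "z \<in> split_product (cimage M i) (cimage N j)"
    using assms(3) by (auto simp: split_product_def cimage_def)
  then show ?thesis
    by (simp add: param_product assms)
qed

lemma smooth_manifold_product: "smooth_manifold (product_manifold M N)"
proof -
  have "homeomorphic_map (subtopology (mtop (product_manifold M N)) (cdom (product_manifold M N) (i, j)))
      (top_of_set (cimage (product_manifold M N) (i, j))) (coord (product_manifold M N) (i, j))"
    if "i \<in> charts M" "j \<in> charts N" for i j
    using homeomorphic_map_join[OF chart_homeomorphism[OF M that(1)] chart_homeomorphism[OF N that(2)]]
    by (simp add: subtopology_Times)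
  moreover have "smooth_on
      (coord (product_manifold M N) (i, j) `
        (cdom (product_manifold M N) (i, j) \<inter> cdom (product_manifold M N) (i', j')))
      (coord (product_manifold M N) (i', j') \<circ> param (product_manifold M N) (i, j))"
    if c: "i \<in> charts M" "j \<in> charts N" "i' \<in> charts M" "j' \<in> charts N" for i j i' j'
  proof -
    note o = open_chart_overlap[OF M c(1,3)] open_chart_overlap[OF N c(2,4)]
    show ?thesis
      unfolding overlap_product
      by (rule smooth_on_cong[OF open_split_product[OF o] transition_product[OF c(1,2), symmetric]],
          assumption)
        (intro smooth_on_join open_split_product smooth_on_split o
          smooth_transition[OF M c(1,3)] smooth_transition[OF N c(2,4)])
  qed
  moreover have "(\<Union>k\<in>charts M \<times> charts N. cdom (product_manifold M N) k) =
      topspace (mtop M) \<times> topspace (mtop N)"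
    using M N unfolding smooth_manifold_def by (force simp: set_eq_iff)
  ultimately show ?thesis
    using M N unfolding smooth_manifold_def
    by (simp add: Hausdorff_space_prod_topology second_countable_prod_topology
        openin_prod_Times_iff open_split_product)
qed

text \<open>A block diagonal Jacobian splits the tensor transformation law of a warped metric into the laws of
  its two blocks; the warping factor is a function and does not transform.\<close>

lemma jacobian_product:
  assumes c: "i \<in> charts M" "j \<in> charts N" "i' \<in> charts M" "j' \<in> charts N"
    and p: "p \<in> cdom M i \<inter> cdom M i'" and q: "q \<in> cdom N j \<inter> cdom N j'"
  shows "jacobian (product_manifold M N) (i, j) (i', j') (p, q) =
    block_diag (jacobian M i i' p) (jacobian N j j' q)"
proof -
  let ?z = "join (coord M i p) (coord N j q)"
  let ?S = "split_product (coord M i ` (cdom M i \<inter> cdom M i')) (coord N j ` (cdom N j \<inter> cdom N j'))"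
  let ?T = "coord M i' \<circ> param M i" and ?R = "coord N j' \<circ> param N j"
  let ?T' = "frechet_derivative ?T (at (coord M i p))" and ?R' = "frechet_derivative ?R (at (coord N j q))"
  have z: "?z \<in> ?S"
    using p q by (simp add: split_product_def)
  have T: "(?T has_derivative ?T') (at (base_part ?z))"
    using smooth_on_has_derivative[OF smooth_transition[OF M c(1,3)]] p by simp
  have R: "(?R has_derivative ?R') (at (fibre_part ?z))"
    using smooth_on_has_derivative[OF smooth_transition[OF N c(2,4)]] q by simp
  have "((\<lambda>z. join (?T (base_part z)) (?R (fibre_part z))) has_derivative
      (\<lambda>v. join (?T' (base_part v)) (?R' (fibre_part v)))) (at ?z)"
    using has_derivative_compose[OF has_derivative_split(1)[OF has_derivative_ident] T]
      has_derivative_compose[OF has_derivative_split(2)[OF has_derivative_ident] R]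
    by (rule has_derivative_join)
  then have "((coord (product_manifold M N) (i', j') \<circ> param (product_manifold M N) (i, j))
      has_derivative (\<lambda>v. join (?T' (base_part v)) (?R' (fibre_part v)))) (at ?z)"
    by (rule has_derivative_transform_within_open[OF _
          open_split_product[OF open_chart_overlap[OF M c(1,3)] open_chart_overlap[OF N c(2,4)]] z])
      (rule transition_product[OF c(1,2), symmetric])
  from frechet_derivative_at[OF this, symmetric]
  have "frechet_derivative (coord (product_manifold M N) (i', j') \<circ> param (product_manifold M N) (i, j))
      (at ?z) = (\<lambda>v. join (?T' (base_part v)) (?R' (fibre_part v)))" .
  then have "jacobian (product_manifold M N) (i, j) (i', j') (p, q) =
      matrix (\<lambda>v. join (?T' (base_part v)) (?R' (fibre_part v)))"
    by (simp add: jacobian_def)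
  moreover have "?T' 0 = 0" "?R' 0 = 0"
    using linear_0[OF has_derivative_linear[OF T]] linear_0[OF has_derivative_linear[OF R]] by auto
  ultimately show ?thesis
    by (simp add: vec_eq_sum_type_iff jacobian_def matrix_def)
qed

end

section \<open>Warped products of semi-Riemannian manifolds\<close>

text \<open>Orthonormal bases of the two blocks combine to one of the whole form, so indices add.\<close>

lemma has_index_block_diag:
  fixes A :: "real^'m::finite^'m" and B :: "real^'d::finite^'d"
  assumes "has_index A \<mu>" "has_index B \<nu>"
  shows "has_index (block_diag A B) (\<mu> + \<nu>)"
proof -
  obtain P :: "real^'m^'m" and e where A: "invertible P" "\<forall>i. e $ i = 1 \<or> e $ i = -1"
    "transpose P ** A ** P = diag_matrix e" "card {i. e $ i = -1} = \<mu>"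
    using assms(1) unfolding has_index_def by auto
  obtain Q :: "real^'d^'d" and e' where B: "invertible Q" "\<forall>i. e' $ i = 1 \<or> e' $ i = -1"
    "transpose Q ** B ** Q = diag_matrix e'" "card {i. e' $ i = -1} = \<nu>"
    using assms(2) unfolding has_index_def by auto
  have "transpose (block_diag P Q) ** block_diag A B ** block_diag P Q =
      block_diag (diag_matrix e) (diag_matrix e')"
    by (simp add: block_diag_transpose block_diag_mult A(3) B(3))
  also have "\<dots> = diag_matrix (join e e')"
    by (simp add: vec_eq_sum_type_iff diag_matrix_nth)
  finally have P: "transpose (block_diag P Q) ** block_diag A B ** block_diag P Q =
      diag_matrix (join e e')" .
  have "k \<in> {k. join e e' $ k = -1} \<longleftrightarrow> k \<in> {i. e $ i = -1} <+> {i. e' $ i = -1}" for k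
    by (cases k) auto
  then have "{k. join e e' $ k = -1} = {i. e $ i = -1} <+> {i. e' $ i = -1}"
    by blast
  then have "card {k. join e e' $ k = -1} = \<mu> + \<nu>"
    by (simp add: card_Plus A(4) B(4))
  moreover have "join e e' $ k = 1 \<or> join e e' $ k = -1" for k
    using A(2) B(2) by (cases k) auto
  ultimately show ?thesis
    unfolding has_index_def using P block_diag_inverse(2)[OF A(1) B(1)] by blast
qed

lemma has_index_scaleR:
  fixes A :: "real^'m::finite^'m"
  assumes "c > 0" "has_index A \<nu>"
  shows "has_index (c *\<^sub>R A) \<nu>"
proof -
  obtain P :: "real^'m^'m" and e where A: "invertible P" "\<forall>i. e $ i = 1 \<or> e $ i = -1"
    "transpose P ** A ** P = diag_matrix e" "card {i. e $ i = -1} = \<nu>"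
    using assms(2) unfolding has_index_def by auto
  \<comment> \<open>Rescaling an orthonormal basis by \<open>1 / sqrt c\<close> compensates the factor \<open>c\<close>.\<close>
  let ?Q = "(1 / sqrt c) *\<^sub>R P"
  have "transpose ?Q ** (c *\<^sub>R A) ** ?Q = (1 / sqrt c * c * (1 / sqrt c)) *\<^sub>R (transpose P ** A ** P)"
    by (simp add: transpose_scalar matrix_scalar_ac flip: scalar_matrix_assoc)
  also have "1 / sqrt c * c * (1 / sqrt c) = 1"
    using assms(1) by (simp add: field_simps)
  finally have "transpose ?Q ** (c *\<^sub>R A) ** ?Q = diag_matrix e"
    using A(3) by simp
  moreover have "invertible ?Q"
    using matrix_inv_scaleR(2)[OF _ A(1), of "1 / sqrt c"] assms(1) by simp
  ultimately show ?thesis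
    unfolding has_index_def using A by blast
qed

lemma smooth_on_block_diag:
  fixes f :: "'a::euclidean_space \<Rightarrow> real^'n::finite^'n" and g :: "'a \<Rightarrow> real^'d::finite^'d"
  assumes "open S" "smooth_on S f" "smooth_on S g"
  shows "smooth_on S (\<lambda>x. block_diag (f x) (g x))"
proof -
  have L: "bounded_linear (\<lambda>A. block_diag A (0::real^'d^'d) :: real^('n + 'd)^('n + 'd))"
    "bounded_linear (\<lambda>B. block_diag (0::real^'n^'n) B :: real^('n + 'd)^('n + 'd))"
    by (simp_all add: linear_iff vec_eq_sum_type_iff flip: linear_conv_bounded_linear)
  have "smooth_on S (\<lambda>x. block_diag (f x) 0 + block_diag 0 (g x))"
    by (rule smooth_on_add[OF assms(1) smooth_on_bounded_linear[OF assms(1) L(1) assms(2)]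
          smooth_on_bounded_linear[OF assms(1) L(2) assms(3)]])
  moreover have "block_diag A 0 + block_diag 0 B = block_diag A B" for A :: "real^'n^'n" and B :: "real^'d^'d"
    by (simp add: vec_eq_sum_type_iff)
  ultimately show ?thesis by simp
qed

lemma semi_riemannian_metric_warped:
  fixes M :: "('i, 'a, 'm::finite) atlas" and N :: "('j, 'b, 'd::finite) atlas"
  assumes M: "smooth_manifold M" and N: "smooth_manifold N"
    and gB: "semi_riemannian_metric M gB" and gF: "semi_riemannian_metric N gF"
    and w: "smooth_function M w" "\<And>i p. i \<in> charts M \<Longrightarrow> p \<in> cdom M i \<Longrightarrow> w p > 0"
  shows "semi_riemannian_metric (product_manifold M N) (warped_metric gB w gF)"
proof -
  let ?P = "product_manifold M N" and ?g = "warped_metric gB w gF"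
  have smooth: "smooth_on (cimage ?P (i, j)) (?g (i, j) \<circ> param ?P (i, j))"
    if c: "i \<in> charts M" "j \<in> charts N" for i j
  proof -
    let ?S = "split_product (cimage M i) (cimage N j)"
    note o = open_cimage[OF M c(1)] open_cimage[OF N c(2)]
    have B: "smooth_on (cimage M i) (gB i \<circ> param M i)" and F: "smooth_on (cimage N j) (gF j \<circ> param N j)"
      and W: "smooth_on (cimage M i) (w \<circ> param M i)"
      using gB gF w c by (simp_all add: semi_riemannian_metric_def smooth_tensor2_def smooth_function_def)
    note S = open_split_product[OF o] and split = smooth_on_split[OF o]
    have "smooth_on ?S (\<lambda>z. block_diag ((gB i \<circ> param M i) (base_part z))
        ((w \<circ> param M i) (base_part z) *\<^sub>R (w \<circ> param M i) (base_part z) *\<^sub>R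
          (gF j \<circ> param N j) (fibre_part z)))"
      by (rule smooth_on_block_diag[OF S split(1)[OF B] smooth_on_scaleR[OF S split(1)[OF W]
            smooth_on_scaleR[OF S split(1)[OF W] split(2)[OF F]]]])
    then show ?thesis
      unfolding cimage_product
      by (rule smooth_on_cong[OF open_split_product[OF o], rotated])
        (simp add: param_product[OF M N c] warped_metric_def power2_eq_square)
  qed
  have law: "?g (i, j) (p, q) = transpose (jacobian ?P (i, j) (i', j') (p, q)) ** ?g (i', j') (p, q) **
      jacobian ?P (i, j) (i', j') (p, q)"
    if c: "i \<in> charts M" "j \<in> charts N" "i' \<in> charts M" "j' \<in> charts N"
      and p: "p \<in> cdom M i \<inter> cdom M i'" and q: "q \<in> cdom N j \<inter> cdom N j'" for i j i' j' p q
  proof -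
    have "gB i p = transpose (jacobian M i i' p) ** gB i' p ** jacobian M i i' p"
      "gF j q = transpose (jacobian N j j' q) ** gF j' q ** jacobian N j j' q"
      using gB gF c p q unfolding semi_riemannian_metric_def smooth_tensor2_def by blast+
    then show ?thesis
      unfolding jacobian_product[OF M N c p q]
      by (simp add: warped_metric_def block_diag_transpose block_diag_mult matrix_scalar_ac
          flip: scalar_matrix_assoc)
  qed
  have nondegenerate: "transpose (?g (i, j) (p, q)) = ?g (i, j) (p, q)" "invertible (?g (i, j) (p, q))"
    if c: "i \<in> charts M" "j \<in> charts N" "p \<in> cdom M i" "q \<in> cdom N j" for i j p q
  proof -
    have *: "transpose (gB i p) = gB i p" "invertible (gB i p)" "transpose (gF j q) = gF j q"
      "invertible (gF j q)"
      using gB gF c by (simp_all add: semi_riemannian_metric_def)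
    have "invertible (block_diag (gB i p) ((w p)\<^sup>2 *\<^sub>R gF j q))"
      using w(2)[OF c(1,3)] by (intro block_diag_inverse(2) matrix_inv_scaleR(2) *) simp
    then show "transpose (?g (i, j) (p, q)) = ?g (i, j) (p, q)" "invertible (?g (i, j) (p, q))"
      using * by (simp_all add: warped_metric_def block_diag_transpose transpose_scalar)
  qed
  obtain \<mu> \<nu> where "\<And>i p. i \<in> charts M \<Longrightarrow> p \<in> cdom M i \<Longrightarrow> has_index (gB i p) \<mu>"
    "\<And>j q. j \<in> charts N \<Longrightarrow> q \<in> cdom N j \<Longrightarrow> has_index (gF j q) \<nu>"
    using gB gF unfolding semi_riemannian_metric_def by blast
  then have index: "has_index (?g (i, j) (p, q)) (\<mu> + \<nu>)"
    if "i \<in> charts M" "j \<in> charts N" "p \<in> cdom M i" "q \<in> cdom N j" for i j p q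
    using w(2)[OF that(1,3)] that
    by (auto simp: warped_metric_def intro!: has_index_block_diag has_index_scaleR)
  have "\<forall>k\<in>charts ?P. smooth_on (cimage ?P k) (?g k \<circ> param ?P k)"
    unfolding product_manifold_simps using smooth by blast
  moreover have "\<forall>k\<in>charts ?P. \<forall>l\<in>charts ?P. \<forall>z\<in>cdom ?P k \<inter> cdom ?P l.
      ?g k z = transpose (jacobian ?P k l z) ** ?g l z ** jacobian ?P k l z"
  proof (intro ballI)
    fix k l z assume "k \<in> charts ?P" "l \<in> charts ?P" "z \<in> cdom ?P k \<inter> cdom ?P l"
    then show "?g k z = transpose (jacobian ?P k l z) ** ?g l z ** jacobian ?P k l z"
      by (cases k; cases l; cases z; hypsubst; intro law) auto
  qed
  moreover have "\<forall>k\<in>charts ?P. \<forall>z\<in>cdom ?P k. transpose (?g k z) = ?g k z \<and> invertible (?g k z)"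
    "\<forall>k\<in>charts ?P. \<forall>z\<in>cdom ?P k. has_index (?g k z) (\<mu> + \<nu>)"
    using nondegenerate index by (simp_all add: Ball_def)
  ultimately show ?thesis
    unfolding semi_riemannian_metric_def smooth_tensor2_def by blast
qed

section \<open>Conformally flat metrics on open subsets of Euclidean space\<close>

lemma open_submanifold_simps [simp]:
  "charts (open_submanifold U) = UNIV" "mtop (open_submanifold U) = top_of_set U"
  "cdom (open_submanifold U) i = U" "coord (open_submanifold U) i x = x"
  "cimage (open_submanifold U) i = U"
  unfolding open_submanifold_def cimage_def atlas.simps image_ident by (rule refl)+

lemma param_open_submanifold [simp]: "x \<in> U \<Longrightarrow> param (open_submanifold U) i x = x"
  unfolding param_def open_submanifold_def atlas.simps by (rule inv_into_f_f[of "\<lambda>x. x"]) simp_all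

lemma second_countable_euclidean:
  "second_countable (euclidean :: 'a::second_countable_topology topology)"
proof -
  obtain B :: "'a set set" where "countable B" "topological_basis B"
    using ex_countable_basis by blast
  moreover have "\<exists>V\<in>B. x \<in> V \<and> V \<subseteq> U" if "open U" "x \<in> U" for U x
    using \<open>topological_basis B\<close> that by (rule topological_basisE) blast
  ultimately show ?thesis
    unfolding second_countable_def open_openin[symmetric] using topological_basis_open by blast
qed

lemma smooth_manifold_open_submanifold:
  fixes U :: "(real^'n::finite) set"
  assumes "open U"
  shows "smooth_manifold (open_submanifold U)"
proof -
  have "homeomorphic_map (top_of_set U) (top_of_set U) (\<lambda>x. x)"
    using homeomorphic_map_id[of "top_of_set U" "top_of_set U"] by (simp add: id_def)
  moreover have "coord (open_submanifold U) i = (\<lambda>x. x)" for i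
    by auto
  moreover have "smooth_on U (coord (open_submanifold U) j \<circ> param (open_submanifold U) i)" for i j
    by (rule smooth_on_cong[OF assms _ smooth_on_linear[OF assms linear_id]]) simp
  ultimately show ?thesis
    using assms by (simp add: smooth_manifold_def Hausdorff_space_subtopology
        second_countable_subtopology second_countable_euclidean subtopology_subtopology)
qed

lemma semi_riemannian_metric_conformally_flat:
  fixes U :: "(real^'n::finite) set"
  assumes U: "open U" and r: "smooth_on U r" "\<And>x. x \<in> U \<Longrightarrow> r x > 0"
    and e: "\<And>i. e $ i = 1 \<or> e $ i = -1"
  shows "semi_riemannian_metric (open_submanifold U) (\<lambda>_ x. r x *\<^sub>R diag_matrix e)"
proof -
  have "smooth_on U ((\<lambda>x. r x *\<^sub>R diag_matrix e) \<circ> param (open_submanifold U) i)" for i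
    by (rule smooth_on_cong[OF U _ smooth_on_scaleR[OF U r(1) smooth_on_const[OF U, of "diag_matrix e"]]])
      simp
  moreover have "jacobian (open_submanifold U) i j x = mat 1" if "x \<in> U" for i j x
  proof -
    have "((\<lambda>x. x) has_derivative (\<lambda>v. v)) (at x)"
      by simp
    then have "(coord (open_submanifold U) j \<circ> param (open_submanifold U) i has_derivative (\<lambda>v. v)) (at x)"
      by (rule has_derivative_transform_within_open[OF _ U that]) simp
    from frechet_derivative_at[OF this, symmetric] show ?thesis
      by (simp add: jacobian_def matrix_def vec_eq_iff axis_def mat_def)
  qed
  moreover have "transpose (diag_matrix e) = diag_matrix e"
    by (simp add: vec_eq_iff transpose_def diag_matrix_nth)
  moreover have "has_index (diag_matrix e) (card {i. e $ i = -1})"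
    unfolding has_index_def using e by (intro exI[of _ "mat 1"] exI[of _ e]) (simp add: invertible_def)
  moreover have "invertible (r x *\<^sub>R diag_matrix e)" if "x \<in> U" for x
    using matrix_inv_scaleR(2)[OF _ diag_matrix_sign_inverse(2)[OF e]] r(2)[OF that] by simp
  ultimately show ?thesis
    unfolding semi_riemannian_metric_def smooth_tensor2_def
    using r(2) by (simp add: transpose_scalar) (use has_index_scaleR in blast)
qed

section \<open>Partial derivatives and local invariance\<close>

lemma has_derivative_cong_open:
  assumes "open W" "y \<in> W" "\<And>z. z \<in> W \<Longrightarrow> F z = F' z"
  shows "(F has_derivative D) (at y) \<longleftrightarrow> (F' has_derivative D) (at y)"
  using has_derivative_transform_within_open[OF _ assms(1,2), of F D UNIV F']
    has_derivative_transform_within_open[OF _ assms(1,2), of F' D UNIV F] assms(3)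
  by auto

text \<open>The partial derivative \<^const>\<open>pd\<close> is defined by choice at points where the function is not
  differentiable. Since functions agreeing near a point have the same derivatives there, the choice
  is the same for both, and the following congruence rules hold without differentiability
  assumptions.\<close>

lemma pd_cong:
  assumes "open W" "y \<in> W" "\<And>z. z \<in> W \<Longrightarrow> F z = F' z"
  shows "pd i F y = pd i F' y"
proof -
  have "frechet_derivative F (at y) = frechet_derivative F' (at y)"
    unfolding frechet_derivative_def using has_derivative_cong_open[OF assms] by presburger
  then show ?thesis by (simp add: pd_def)
qed

lemma pd_eqI: "(F has_derivative D) (at y) \<Longrightarrow> pd i F y = D (axis i 1)"
  unfolding pd_def using frechet_derivative_at by metis

lemma pd_const [simp]: "pd i (\<lambda>z. c) y = 0"
  by (subst pd_eqI[OF has_derivative_const]) simp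

context
  fixes W :: "(real^'m::finite) set" and G G' :: "real^'m \<Rightarrow> real^'m^'m"
  assumes W: "open W" and eq: "\<And>z. z \<in> W \<Longrightarrow> G z = G' z"
begin

lemma christoffel_cong:
  assumes "y \<in> W"
  shows "christoffel G k i j y = christoffel G' k i j y"
proof -
  have "pd a (\<lambda>z. G z $ b $ c) y = pd a (\<lambda>z. G' z $ b $ c) y" for a b c
    by (rule pd_cong[OF W assms]) (simp add: eq)
  then show ?thesis
    by (simp add: christoffel_def eq[OF assms])
qed

lemma scalar_curv_cong:
  assumes "y \<in> W"
  shows "scalar_curv G y = scalar_curv G' y"
proof -
  have "pd a (christoffel G k i j) y = pd a (christoffel G' k i j) y" for a k i j
    by (rule pd_cong[OF W assms]) (rule christoffel_cong)
  then show ?thesis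
    by (simp add: scalar_curv_def ricci_def eq[OF assms] christoffel_cong[OF assms])
qed

lemma hess_cong:
  assumes "y \<in> W" "\<And>z. z \<in> W \<Longrightarrow> U z = U' z"
  shows "hess G U y = hess G' U' y"
proof -
  have 1: "pd j U z = pd j U' z" if "z \<in> W" for j z
    by (rule pd_cong[OF W that]) (rule assms(2))
  have "pd i (pd j U) y = pd i (pd j U') y" for i j
    by (rule pd_cong[OF W assms(1)]) (rule 1)
  then show ?thesis
    by (simp add: hess_def christoffel_cong[OF assms(1)] 1[OF assms(1)])
qed

end

lemma differentiable_cong_open:
  assumes "open W" "y \<in> W" "\<And>z. z \<in> W \<Longrightarrow> F z = F' z" "F' differentiable (at y)"
  shows "F differentiable (at y)"
  using has_derivative_cong_open[OF assms(1-3)] assms(4) unfolding differentiable_def by simp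

lemma det_differentiable:
  fixes A :: "'a::real_normed_vector \<Rightarrow> real^'m::finite^'m"
  assumes "\<And>i j. (\<lambda>y. A y $ i $ j) differentiable (at x)"
  shows "(\<lambda>y. det (A y)) differentiable (at x)"
proof -
  have "\<forall>i j. \<exists>D. ((\<lambda>y. A y $ i $ j) has_derivative D) (at x)"
    using assms unfolding differentiable_def by blast
  then obtain D where D: "\<And>i j. ((\<lambda>y. A y $ i $ j) has_derivative D i j) (at x)"
    by metis
  show ?thesis
    unfolding det_def
    by (rule differentiableI, rule has_derivative_sum, rule has_derivative_mult_right,
        rule has_derivative_prod, rule D)
qed

text \<open>By Cramer's rule the entries of the inverse are quotients of determinants.\<close>

lemma matrix_inv_differentiable:
  fixes A :: "'a::real_normed_vector \<Rightarrow> real^'m::finite^'m"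
  assumes "\<And>i j. (\<lambda>y. A y $ i $ j) differentiable (at x)"
    and "open S" "x \<in> S" "\<And>y. y \<in> S \<Longrightarrow> invertible (A y)"
  shows "(\<lambda>y. matrix_inv (A y) $ k $ l) differentiable (at x)"
proof -
  let ?N = "\<lambda>y. \<chi> i j. if j = k then axis l 1 $ i else A y $ i $ j"
  have "(\<lambda>y. ?N y $ i $ j) differentiable (at x)" for i j
    using assms(1)[of i j] by (cases "j = k") simp_all
  then have "(\<lambda>y. det (?N y)) differentiable (at x)"
    by (rule det_differentiable)
  moreover have "(\<lambda>y. det (A y)) differentiable (at x)"
    by (rule det_differentiable) (rule assms(1))
  moreover note d = invertible_det_nz[THEN iffD1, OF assms(4)]
  ultimately have quotient: "(\<lambda>y. det (?N y) / det (A y)) differentiable (at x)"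
    by (rule differentiable_divide) (rule assms(3))
  have "matrix_inv (A y) $ k $ l = det (?N y) / det (A y)" if "y \<in> S" for y
  proof -
    have "A y *v column l (matrix_inv (A y)) = axis l 1"
      by (simp add: matrix_vector_mult_basis[symmetric] matrix_vector_mul_assoc
          matrix_inv_works[OF assms(4)[OF that]])
    then have "column l (matrix_inv (A y)) =
        (\<chi> k. det (\<chi> i j. if j = k then axis l 1 $ i else A y $ i $ j) / det (A y))"
      using cramer[OF d[OF that]] by blast
    then have "column l (matrix_inv (A y)) $ k = det (?N y) / det (A y)"
      by simp
    then show ?thesis
      by (simp add: column_def)
  qed
  then show ?thesis
    by (rule differentiable_cong_open[OF assms(2,3) _ quotient])
qed

lemma smooth_on_component_differentiable:
  fixes H :: "'a::euclidean_space \<Rightarrow> real^'m::finite^'m"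
  assumes "smooth_on V H" "y \<in> V"
  shows "(\<lambda>y. H y $ a $ b) differentiable (at y)"
    and "((\<lambda>y. H y $ a $ b) has_derivative (\<lambda>v. frechet_derivative H (at y) v $ a $ b)) (at y)"
proof -
  have "((\<lambda>y. H y $ a $ b) has_derivative (\<lambda>v. frechet_derivative H (at y) v $ a $ b)) (at y)"
    using bounded_linear.has_derivative[OF bounded_linear_vec_nth
        bounded_linear.has_derivative[OF bounded_linear_vec_nth smooth_on_has_derivative[OF assms]]] .
  then show "(\<lambda>y. H y $ a $ b) differentiable (at y)"
    and "((\<lambda>y. H y $ a $ b) has_derivative (\<lambda>v. frechet_derivative H (at y) v $ a $ b)) (at y)"
    by (auto simp: differentiable_def)
qed

text \<open>Differentiating the Christoffel symbols of the fibre along the projection from the product needs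
  the chain rule, which is available only for differentiable functions.\<close>

lemma christoffel_differentiable:
  fixes H :: "real^'m::finite \<Rightarrow> real^'m^'m"
  assumes "open V" "smooth_on V H" "\<And>y. y \<in> V \<Longrightarrow> invertible (H y)" "y \<in> V"
  shows "christoffel H k a b differentiable (at y)"
proof -
  have inv: "(\<lambda>y. matrix_inv (H y) $ k $ l) differentiable (at y)" for k l
    by (rule matrix_inv_differentiable[OF smooth_on_component_differentiable(1)[OF assms(2,4)]
          assms(1,4,3)])
  have pd: "pd a (\<lambda>z. H z $ b $ c) differentiable (at y)" for a b c
  proof -
    have 1: "pd a (\<lambda>z. H z $ b $ c) z = frechet_derivative H (at z) (axis a 1) $ b $ c" if "z \<in> V" for z
      by (rule pd_eqI[OF smooth_on_component_differentiable(2)[OF assms(2) that]])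
    have 2: "(\<lambda>z. frechet_derivative H (at z) (axis a 1) $ b $ c) differentiable (at y)"
      by (rule smooth_on_component_differentiable(1)[OF smooth_on_frechet_derivative[OF assms(2)] assms(4)])
    show ?thesis
      by (rule differentiable_cong_open[OF assms(1,4) 1 2])
  qed
  have "(\<lambda>y. (1/2) * (\<Sum>l\<in>UNIV. matrix_inv (H y) $ k $ l *
     (pd a (\<lambda>z. H z $ b $ l) y + pd b (\<lambda>z. H z $ a $ l) y - pd l (\<lambda>z. H z $ a $ b) y)))
     differentiable (at y)"
    by (rule differentiable_mult[OF differentiable_const differentiable_sum[OF finite]],
        rule ballI, rule differentiable_mult[OF inv differentiable_diff[OF differentiable_add[OF pd pd] pd]])
  then show ?thesis
    unfolding christoffel_def[abs_def] .
qed

section \<open>Curvature and Hessian of the warped metric in coordinates\<close>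

text \<open>The metric \<open>\<delta> / \<phi>\<^sup>2 + f\<^sup>2 H\<close> in product coordinates, where \<open>H\<close> is the metric of the fibre in one
  chart with image \<open>V\<close>. The functions \<open>\<phi>\<close> and \<open>f\<close> depend on the value of the null linear form
  only.\<close>

locale null_warped_coordinates =
  fixes \<epsilon> \<alpha> :: "real^'n::finite" and \<phi> f :: "real \<Rightarrow> real" and I :: "real set"
    and V :: "(real^'d::finite) set" and H :: "real^'d \<Rightarrow> real^'d^'d"
  assumes sign: "\<epsilon> $ i = 1 \<or> \<epsilon> $ i = -1"
    and null: "(\<Sum>i\<in>UNIV. \<epsilon> $ i * (\<alpha> $ i)\<^sup>2) = 0"
    and I: "open I" and V: "open V"
    and \<phi>: "smooth_on I \<phi>" "t \<in> I \<Longrightarrow> \<phi> t > 0"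
    and f: "smooth_on I f" "t \<in> I \<Longrightarrow> f t > 0"
    and H: "smooth_on V H" "y \<in> V \<Longrightarrow> transpose (H y) = H y" "y \<in> V \<Longrightarrow> invertible (H y)"
begin

definition \<xi> :: "real^('n + 'd) \<Rightarrow> real" where
  "\<xi> z = \<alpha> \<bullet> base_part z"

definition W :: "(real^('n + 'd)) set" where
  "W = split_product {x. \<alpha> \<bullet> x \<in> I} V"

definition G :: "real^('n + 'd) \<Rightarrow> real^('n + 'd)^('n + 'd)" where
  "G z = block_diag ((1 / (\<phi> (\<xi> z))\<^sup>2) *\<^sub>R diag_matrix \<epsilon>) ((f (\<xi> z))\<^sup>2 *\<^sub>R H (fibre_part z))"

text \<open>Logarithmic derivatives of the conformal factor \<open>1 / \<phi>\<close> and of the warping function, and the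
  profile of the normal components of the Christoffel symbols in fibre directions.\<close>

definition c :: "real \<Rightarrow> real" where "c t = - deriv \<phi> t / \<phi> t"
definition m :: "real \<Rightarrow> real" where "m t = deriv f t / f t"
definition p :: "real \<Rightarrow> real" where "p t = (\<phi> t)\<^sup>2 * f t * deriv f t"

lemma open_W: "open W"
proof -
  have "open {x. \<alpha> \<bullet> x \<in> I}"
    using open_vimage[OF I, of "\<lambda>x. \<alpha> \<bullet> x"] by (simp add: vimage_def continuous_intros)
  then show ?thesis
    unfolding W_def by (rule open_split_product[OF _ V])
qed

lemma W_D: "z \<in> W \<Longrightarrow> \<xi> z \<in> I" "z \<in> W \<Longrightarrow> fibre_part z \<in> V"
  by (simp_all add: W_def \<xi>_def split_product_def)

subsection \<open>Partial derivatives\<close>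

text \<open>All components of the metric and all its Christoffel symbols are products of a function of the
  null form and a function on the fibre, so this rule covers every partial derivative below.\<close>

lemma pd_separated:
  assumes w: "(w has_real_derivative w') (at (\<xi> z))" and F: "F differentiable (at (fibre_part z))"
  shows "pd (Inl i) (\<lambda>z. w (\<xi> z) * F (fibre_part z)) z = w' * \<alpha> $ i * F (fibre_part z)"
    and "pd (Inr a) (\<lambda>z. w (\<xi> z) * F (fibre_part z)) z = w (\<xi> z) * pd a F (fibre_part z)"
proof -
  let ?F' = "frechet_derivative F (at (fibre_part z))"
  have F': "(F has_derivative ?F') (at (fibre_part z))"
    using F frechet_derivative_works by blast
  have "(\<xi> has_derivative (\<lambda>v. \<alpha> \<bullet> base_part v)) (at z)"
    unfolding \<xi>_def
    by (rule has_derivative_inner_right[OF has_derivative_split(1)[OF has_derivative_ident]])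
  from has_derivative_compose[OF this has_field_derivative_imp_has_derivative[OF w]]
    has_derivative_compose[OF has_derivative_split(2)[OF has_derivative_ident] F']
  have "((\<lambda>z. w (\<xi> z) * F (fibre_part z)) has_derivative
      (\<lambda>v. w (\<xi> z) * ?F' (fibre_part v) + w' * (\<alpha> \<bullet> base_part v) * F (fibre_part z))) (at z)"
    by (rule has_derivative_mult)
  note pd = pd_eqI[OF this]
  show "pd (Inl i) (\<lambda>z. w (\<xi> z) * F (fibre_part z)) z = w' * \<alpha> $ i * F (fibre_part z)"
    using linear_0[OF has_derivative_linear[OF F']] by (simp add: pd inner_axis)
  show "pd (Inr a) (\<lambda>z. w (\<xi> z) * F (fibre_part z)) z = w (\<xi> z) * pd a F (fibre_part z)"
    unfolding pd by (simp add: pd_def)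
qed

lemma pd_profile:
  assumes w: "(w has_real_derivative w') (at (\<xi> z))"
  shows "pd (Inl i) (\<lambda>z. w (\<xi> z)) z = w' * \<alpha> $ i" and "pd (Inr a) (\<lambda>z. w (\<xi> z)) z = 0"
  using pd_separated[OF w, of "\<lambda>_. 1"] by simp_all

lemma pd_fibre:
  fixes F :: "real^'d \<Rightarrow> real" and z :: "real^('n + 'd)"
  assumes "F differentiable (at (fibre_part z))"
  shows "pd (Inl i) (\<lambda>z. F (fibre_part z)) z = 0"
    and "pd (Inr a) (\<lambda>z. F (fibre_part z)) z = pd a F (fibre_part z)"
  using pd_separated[of "\<lambda>_. 1" 0 z, OF _ assms] by simp_all

lemma deriv_profiles:
  assumes "t \<in> I"
  shows "(\<phi> has_real_derivative deriv \<phi> t) (at t)" "(f has_real_derivative deriv f t) (at t)"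
    "(deriv \<phi> has_real_derivative deriv (deriv \<phi>) t) (at t)"
    "(deriv f has_real_derivative deriv (deriv f) t) (at t)"
  by (rule smooth_on_deriv(1)[OF I _ assms], rule \<phi>(1) f(1) smooth_on_deriv(2)[OF I \<phi>(1)]
      smooth_on_deriv(2)[OF I f(1)])+

lemma deriv_coefficients:
  assumes "t \<in> I"
  shows "(c has_real_derivative deriv c t) (at t)" "(m has_real_derivative deriv m t) (at t)"
    "(p has_real_derivative deriv p t) (at t)"
proof -
  note d = deriv_profiles[OF assms]
  have "\<phi> t \<noteq> 0" "f t \<noteq> 0"
    using \<phi>(2)[OF assms] f(2)[OF assms] by auto
  have deriv: "(g has_real_derivative deriv g t) (at t)" if "(g has_real_derivative D) (at t)" for g D
    using that DERIV_imp_deriv[OF that] by simp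
  show "(c has_real_derivative deriv c t) (at t)"
    unfolding c_def[abs_def] by (rule deriv[OF DERIV_divide[OF DERIV_minus[OF d(3)] d(1) \<open>\<phi> t \<noteq> 0\<close>]])
  show "(m has_real_derivative deriv m t) (at t)"
    unfolding m_def[abs_def] by (rule deriv[OF DERIV_divide[OF d(4,2) \<open>f t \<noteq> 0\<close>]])
  show "(p has_real_derivative deriv p t) (at t)"
    unfolding p_def[abs_def] by (rule deriv[OF DERIV_mult[OF DERIV_mult[OF DERIV_power[OF d(1)] d(2)] d(4)]])
qed

lemma deriv_metric_factors:
  assumes "t \<in> I"
  shows "((\<lambda>t. 1 / (\<phi> t)\<^sup>2) has_real_derivative 2 * c t / (\<phi> t)\<^sup>2) (at t)"
    "((\<lambda>t. (f t)\<^sup>2) has_real_derivative 2 * f t * deriv f t) (at t)"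
proof -
  have "\<phi> t \<noteq> 0"
    using \<phi>(2)[OF assms] by auto
  then show "((\<lambda>t. 1 / (\<phi> t)\<^sup>2) has_real_derivative 2 * c t / (\<phi> t)\<^sup>2) (at t)"
    by (auto intro!: derivative_eq_intros deriv_profiles(1)[OF assms]
        simp: c_def field_simps power2_eq_square eval_nat_numeral)
  show "((\<lambda>t. (f t)\<^sup>2) has_real_derivative 2 * f t * deriv f t) (at t)"
    by (auto intro!: derivative_eq_intros deriv_profiles(2)[OF assms])
qed

lemma H_differentiable: "y \<in> V \<Longrightarrow> (\<lambda>y. H y $ a $ b) differentiable (at y)"
  by (rule smooth_on_component_differentiable(1)[OF H(1)])

lemma pd_G:
  assumes "z \<in> W"
  defines "t \<equiv> \<xi> z"
  shows "pd (Inl k) (\<lambda>z. G z $ Inl i $ Inl j) z = 2 * c t / (\<phi> t)\<^sup>2 * \<alpha> $ k * diag_matrix \<epsilon> $ i $ j"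
    and "pd (Inr e) (\<lambda>z. G z $ Inl i $ Inl j) z = 0"
    and "pd K (\<lambda>z. G z $ Inl i $ Inr b) z = 0" and "pd K (\<lambda>z. G z $ Inr a $ Inl j) z = 0"
    and "pd (Inl k) (\<lambda>z. G z $ Inr a $ Inr b) z = 2 * f t * deriv f t * \<alpha> $ k * H (fibre_part z) $ a $ b"
    and "pd (Inr e) (\<lambda>z. G z $ Inr a $ Inr b) z = (f t)\<^sup>2 * pd e (\<lambda>y. H y $ a $ b) (fibre_part z)"
proof -
  note t = W_D(1)[OF assms(1)]
  have 1: "(\<lambda>z. G z $ Inl i $ Inl j) = (\<lambda>z. 1 / (\<phi> (\<xi> z))\<^sup>2 * diag_matrix \<epsilon> $ i $ j)"
    and 2: "(\<lambda>z. G z $ Inr a $ Inr b) = (\<lambda>z. (f (\<xi> z))\<^sup>2 * H (fibre_part z) $ a $ b)"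
    and 3: "(\<lambda>z. G z $ Inl i $ Inr b) = (\<lambda>z. 0)" "(\<lambda>z. G z $ Inr a $ Inl j) = (\<lambda>z. 0)"
    by (simp_all add: G_def fun_eq_iff)
  show "pd (Inl k) (\<lambda>z. G z $ Inl i $ Inl j) z = 2 * c t / (\<phi> t)\<^sup>2 * \<alpha> $ k * diag_matrix \<epsilon> $ i $ j"
    "pd (Inr e) (\<lambda>z. G z $ Inl i $ Inl j) z = 0"
    unfolding 1 t_def
    using pd_separated[OF deriv_metric_factors(1)[OF t], of "\<lambda>_. diag_matrix \<epsilon> $ i $ j"] by simp_all
  show "pd K (\<lambda>z. G z $ Inl i $ Inr b) z = 0" "pd K (\<lambda>z. G z $ Inr a $ Inl j) z = 0"
    unfolding 3 by simp_all
  show "pd (Inl k) (\<lambda>z. G z $ Inr a $ Inr b) z = 2 * f t * deriv f t * \<alpha> $ k * H (fibre_part z) $ a $ b"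
    "pd (Inr e) (\<lambda>z. G z $ Inr a $ Inr b) z = (f t)\<^sup>2 * pd e (\<lambda>y. H y $ a $ b) (fibre_part z)"
    unfolding 2 t_def
    by (rule pd_separated[OF deriv_metric_factors(2)[OF t] H_differentiable[OF W_D(2)[OF assms(1)]]])+
qed

lemma matrix_inv_G:
  assumes "z \<in> W"
  shows "matrix_inv (G z) = block_diag ((\<phi> (\<xi> z))\<^sup>2 *\<^sub>R diag_matrix \<epsilon>)
    ((1 / (f (\<xi> z))\<^sup>2) *\<^sub>R matrix_inv (H (fibre_part z)))"
proof -
  have nz: "1 / (\<phi> (\<xi> z))\<^sup>2 \<noteq> 0" "(f (\<xi> z))\<^sup>2 \<noteq> 0"
    using \<phi>(2) f(2) W_D(1)[OF assms] by (simp_all add: less_imp_neq[symmetric])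
  note D = diag_matrix_sign_inverse[OF sign] and Hi = H(3)[OF W_D(2)[OF assms]]
  have "matrix_inv (G z) = block_diag (matrix_inv ((1 / (\<phi> (\<xi> z))\<^sup>2) *\<^sub>R diag_matrix \<epsilon>))
      (matrix_inv ((f (\<xi> z))\<^sup>2 *\<^sub>R H (fibre_part z)))"
    unfolding G_def
    by (rule block_diag_inverse(1)[OF matrix_inv_scaleR(2)[OF nz(1) D(2)]
          matrix_inv_scaleR(2)[OF nz(2) Hi]])
  also have "\<dots> = block_diag ((\<phi> (\<xi> z))\<^sup>2 *\<^sub>R diag_matrix \<epsilon>)
      ((1 / (f (\<xi> z))\<^sup>2) *\<^sub>R matrix_inv (H (fibre_part z)))"
    unfolding matrix_inv_scaleR(1)[OF nz(1) D(2)] matrix_inv_scaleR(1)[OF nz(2) Hi] D(1) by simp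
  finally show ?thesis .
qed

subsection \<open>Christoffel symbols\<close>

text \<open>The Christoffel symbols of the conformally flat metric \<open>\<delta> / \<phi>\<^sup>2\<close>, with their common factor
  \<open>c\<close> taken out.\<close>

definition conf :: "'n \<Rightarrow> 'n \<Rightarrow> 'n \<Rightarrow> real" where
  "conf k i j = (if k = i then \<alpha> $ j else 0) + (if k = j then \<alpha> $ i else 0)
     - (if i = j then \<epsilon> $ i * \<epsilon> $ k * \<alpha> $ k else 0)"

lemma sign_square: "\<epsilon> $ i * \<epsilon> $ i = 1"
  using sign[of i] by auto

lemma diag_matrix_lower: "\<epsilon> $ k * diag_matrix \<epsilon> $ i $ k = (if k = i then 1 else 0)"
  "\<epsilon> $ k * diag_matrix \<epsilon> $ k $ i = (if k = i then 1 else 0)"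
  by (simp_all add: diag_matrix_nth sign_square)

lemma sum_matrix_inv_H:
  assumes "z \<in> W"
  shows "(\<Sum>l\<in>UNIV. matrix_inv (H (fibre_part z)) $ a $ l * H (fibre_part z) $ b $ l) = (if a = b then 1 else 0)"
proof -
  let ?H = "H (fibre_part z)"
  have "matrix_inv ?H ** ?H = mat 1"
    using matrix_inv_works[OF H(3)[OF W_D(2)[OF assms]]] matrix_left_right_inverse by blast
  then have "(matrix_inv ?H ** transpose ?H) $ a $ b = mat 1 $ a $ b"
    using H(2)[OF W_D(2)[OF assms]] by simp
  then show ?thesis
    by (simp add: matrix_matrix_mult_def transpose_def mat_def)
qed

lemma christoffel_base:
  assumes "z \<in> W"
  shows "christoffel G (Inl k) (Inl i) (Inl j) z = c (\<xi> z) * conf k i j"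
    and "christoffel G (Inl k) (Inl i) (Inr b) z = 0" "christoffel G (Inl k) (Inr b) (Inl i) z = 0"
    and "christoffel G (Inl k) (Inr a) (Inr b) z =
      - p (\<xi> z) * (\<epsilon> $ k * \<alpha> $ k) * H (fibre_part z) $ a $ b"
proof -
  have sum: "(\<Sum>l\<in>UNIV. matrix_inv (G z) $ Inl k $ l * v l) = (\<phi> (\<xi> z))\<^sup>2 * \<epsilon> $ k * v (Inl k)" for v
    by (simp add: sum_sum_type matrix_inv_G[OF assms] sum_diag_matrix mult.assoc flip: sum_distrib_left)
  have nz: "\<phi> (\<xi> z) \<noteq> 0"
    using \<phi>(2)[OF W_D(1)[OF assms]] by simp
  note simps = christoffel_def sum pd_G[OF assms]
  have "christoffel G (Inl k) (Inl i) (Inl j) z = c (\<xi> z) * (\<alpha> $ i * (\<epsilon> $ k * diag_matrix \<epsilon> $ j $ k) +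
      \<alpha> $ j * (\<epsilon> $ k * diag_matrix \<epsilon> $ i $ k) - \<epsilon> $ k * \<alpha> $ k * diag_matrix \<epsilon> $ i $ j)"
    unfolding simps using nz by (simp add: field_simps)
  also have "\<dots> = c (\<xi> z) * conf k i j"
    unfolding diag_matrix_lower by (simp add: conf_def diag_matrix_nth)
  finally show "christoffel G (Inl k) (Inl i) (Inl j) z = c (\<xi> z) * conf k i j" .
  show "christoffel G (Inl k) (Inl i) (Inr b) z = 0" "christoffel G (Inl k) (Inr b) (Inl i) z = 0"
    by (simp_all add: simps)
  show "christoffel G (Inl k) (Inr a) (Inr b) z =
      - p (\<xi> z) * (\<epsilon> $ k * \<alpha> $ k) * H (fibre_part z) $ a $ b"
    by (simp add: simps p_def)
qed

lemma christoffel_fibre: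
  assumes "z \<in> W"
  shows "christoffel G (Inr a) (Inl i) (Inl j) z = 0"
    and "christoffel G (Inr a) (Inl i) (Inr b) z = m (\<xi> z) * \<alpha> $ i * (if a = b then 1 else 0)"
    and "christoffel G (Inr a) (Inr b) (Inl i) z = m (\<xi> z) * \<alpha> $ i * (if a = b then 1 else 0)"
    and "christoffel G (Inr a) (Inr b) (Inr e) z = christoffel H a b e (fibre_part z)"
proof -
  let ?y = "fibre_part z" and ?t = "\<xi> z"
  have sum: "(\<Sum>l\<in>UNIV. matrix_inv (G z) $ Inr a $ l * v l) =
      (1 / (f ?t)\<^sup>2) * (\<Sum>l\<in>UNIV. matrix_inv (H ?y) $ a $ l * v (Inr l))" for v
    by (simp add: sum_sum_type matrix_inv_G[OF assms] sum_distrib_left)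
  have nz: "f ?t \<noteq> 0"
    using f(2)[OF W_D(1)[OF assms]] by simp
  have "(\<Sum>l\<in>UNIV. matrix_inv (H ?y) $ a $ l * (2 * f ?t * deriv f ?t * \<alpha> $ i * H ?y $ b $ l)) =
      2 * f ?t * deriv f ?t * \<alpha> $ i * (\<Sum>l\<in>UNIV. matrix_inv (H ?y) $ a $ l * H ?y $ b $ l)"
    by (simp add: sum_distrib_left mult_ac)
  also note sum_matrix_inv_H[OF assms]
  finally have mixed: "(\<Sum>l\<in>UNIV. matrix_inv (H ?y) $ a $ l *
      (2 * f ?t * deriv f ?t * \<alpha> $ i * H ?y $ b $ l)) =
      2 * f ?t * deriv f ?t * \<alpha> $ i * (if a = b then 1 else 0)" .
  note simps = christoffel_def sum pd_G[OF assms]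
  show "christoffel G (Inr a) (Inl i) (Inl j) z = 0"
    by (simp add: simps)
  have coefficient: "(1/2) * ((1 / (f ?t)\<^sup>2) * (2 * f ?t * deriv f ?t * \<alpha> $ i * x)) = m ?t * \<alpha> $ i * x" for x
    using nz by (simp add: m_def field_simps power2_eq_square)
  show "christoffel G (Inr a) (Inl i) (Inr b) z = m ?t * \<alpha> $ i * (if a = b then 1 else 0)"
    "christoffel G (Inr a) (Inr b) (Inl i) z = m ?t * \<alpha> $ i * (if a = b then 1 else 0)"
    unfolding simps by (simp_all only: add_0_left add_0_right diff_zero mixed coefficient)
  have "(\<Sum>l\<in>UNIV. matrix_inv (H ?y) $ a $ l * ((f ?t)\<^sup>2 * X l + (f ?t)\<^sup>2 * Y l - (f ?t)\<^sup>2 * Z l)) =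
      (f ?t)\<^sup>2 * (\<Sum>l\<in>UNIV. matrix_inv (H ?y) $ a $ l * (X l + Y l - Z l))" for X Y Z
    by (simp add: sum_distrib_left algebra_simps)
  then show "christoffel G (Inr a) (Inr b) (Inr e) z = christoffel H a b e ?y"
    unfolding simps using nz by (simp add: christoffel_def)
qed

subsection \<open>Ricci and scalar curvature\<close>

text \<open>The null condition in the form in which it occurs below: every sum that contracts the gradient of
  one function of the form with that of another vanishes.\<close>

lemma null_sum: "(\<Sum>k\<in>UNIV. \<alpha> $ k * (\<epsilon> $ k * \<alpha> $ k)) = 0"
  using null by (simp add: power2_eq_square mult_ac)

lemma conf_trace [simp]: "conf k k l = \<alpha> $ l" "conf k l k = \<alpha> $ l"
  by (auto simp: conf_def sign_square)

lemma sum_conf_upper: "(\<Sum>k\<in>UNIV. \<alpha> $ k * conf k i j) = 2 * \<alpha> $ i * \<alpha> $ j"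
proof -
  have "\<alpha> $ k * conf k i j = (if k = i then \<alpha> $ i * \<alpha> $ j else 0) + (if k = j then \<alpha> $ j * \<alpha> $ i else 0)
      - (if i = j then \<epsilon> $ i else 0) * (\<alpha> $ k * (\<epsilon> $ k * \<alpha> $ k))" for k
    by (auto simp: conf_def algebra_simps)
  then show ?thesis
    by (simp add: sum.distrib sum_subtractf null_sum flip: sum_distrib_left)
qed

text \<open>Contraction against an arbitrary vector; the quadratic contraction of the symbols needed for the
  Ricci tensor is obtained by applying it twice.\<close>

lemma sum_conf_lower:
  "(\<Sum>l\<in>UNIV. conf k j l * v l) =
     (if k = j then \<Sum>l\<in>UNIV. \<alpha> $ l * v l else 0) + \<alpha> $ j * v k - \<epsilon> $ j * \<epsilon> $ k * \<alpha> $ k * v j"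
proof -
  have "conf k j l * v l = (if k = j then 1 else 0) * (\<alpha> $ l * v l) + (if l = k then \<alpha> $ j * v k else 0)
      - (if l = j then \<epsilon> $ j * \<epsilon> $ k * \<alpha> $ k * v j else 0)" for l
    by (auto simp: conf_def algebra_simps)
  then show ?thesis
    by (simp add: sum.distrib sum_subtractf flip: sum_distrib_left)
qed

lemma sum_conf_conf:
  "(\<Sum>k\<in>UNIV. \<Sum>l\<in>UNIV. conf k j l * conf l i k) = (real CARD('n) + 2) * (\<alpha> $ i * \<alpha> $ j)"
proof -
  have "(\<Sum>k\<in>UNIV. conf j i k * (\<epsilon> $ j * \<epsilon> $ k * \<alpha> $ k)) =
      \<epsilon> $ j * (\<Sum>k\<in>UNIV. conf j i k * (\<epsilon> $ k * \<alpha> $ k))"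
    by (simp add: sum_distrib_left mult_ac)
  also have "(\<Sum>k\<in>UNIV. conf j i k * (\<epsilon> $ k * \<alpha> $ k)) = \<alpha> $ i * (\<epsilon> $ j * \<alpha> $ j) * (1 - \<epsilon> $ i * \<epsilon> $ i)"
    unfolding sum_conf_lower null_sum by (simp add: algebra_simps)
  finally have 0: "(\<Sum>k\<in>UNIV. conf j i k * (\<epsilon> $ j * \<epsilon> $ k * \<alpha> $ k)) = 0"
    by (simp add: sign_square)
  have "(\<Sum>k\<in>UNIV. \<Sum>l\<in>UNIV. conf k j l * conf l i k) =
      (\<Sum>k\<in>UNIV. (if k = j then 2 * \<alpha> $ i * \<alpha> $ j else 0) + \<alpha> $ j * \<alpha> $ i
        - conf j i k * (\<epsilon> $ j * \<epsilon> $ k * \<alpha> $ k))"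
    unfolding sum_conf_lower sum_conf_upper by (intro sum.cong) auto
  also have "\<dots> = (real CARD('n) + 2) * (\<alpha> $ i * \<alpha> $ j)"
    unfolding sum.distrib sum_subtractf 0 by (simp add: algebra_simps)
  finally show ?thesis .
qed

lemma pd_christoffel:
  assumes "z \<in> W"
  shows "pd (Inl l) (christoffel G (Inl k) (Inl i) (Inl j)) z = deriv c (\<xi> z) * \<alpha> $ l * conf k i j"
    and "pd K (christoffel G (Inr a) (Inl i) (Inl j)) z = 0"
    and "pd (Inl l) (christoffel G (Inr a) (Inl i) (Inr b)) z =
      deriv m (\<xi> z) * \<alpha> $ l * (\<alpha> $ i * (if a = b then 1 else 0))"
    and "pd (Inl l) (christoffel G (Inl k) (Inr a) (Inr b)) z =
      deriv p (\<xi> z) * \<alpha> $ l * (- (\<epsilon> $ k * \<alpha> $ k) * H (fibre_part z) $ a $ b)"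
    and "pd K (christoffel G (Inl k) (Inr a) (Inl i)) z = 0"
    and "pd (Inr e) (christoffel G (Inr a) (Inr b) (Inr b')) z =
      pd e (christoffel H a b b') (fibre_part z)"
proof -
  note cong = pd_cong[OF open_W assms] and t = W_D(1)[OF assms] and y = W_D(2)[OF assms]
  note d = deriv_coefficients[OF t]
  have "pd (Inl l) (christoffel G (Inl k) (Inl i) (Inl j)) z = pd (Inl l) (\<lambda>z. c (\<xi> z) * conf k i j) z"
    by (rule cong) (rule christoffel_base(1))
  then show "pd (Inl l) (christoffel G (Inl k) (Inl i) (Inl j)) z = deriv c (\<xi> z) * \<alpha> $ l * conf k i j"
    using pd_separated(1)[OF d(1), of "\<lambda>_. conf k i j"] by simp
  have "pd K (christoffel G (Inr a) (Inl i) (Inl j)) z = pd K (\<lambda>z. 0) z"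
    by (rule cong) (rule christoffel_fibre(1))
  then show "pd K (christoffel G (Inr a) (Inl i) (Inl j)) z = 0"
    by simp
  have "pd (Inl l) (christoffel G (Inr a) (Inl i) (Inr b)) z =
      pd (Inl l) (\<lambda>z. m (\<xi> z) * (\<alpha> $ i * (if a = b then 1 else 0))) z"
    by (rule cong) (simp add: christoffel_fibre(2))
  then show "pd (Inl l) (christoffel G (Inr a) (Inl i) (Inr b)) z =
      deriv m (\<xi> z) * \<alpha> $ l * (\<alpha> $ i * (if a = b then 1 else 0))"
    using pd_separated(1)[OF d(2), of "\<lambda>_. \<alpha> $ i * (if a = b then 1 else 0)"] by simp
  have "pd (Inl l) (christoffel G (Inl k) (Inr a) (Inr b)) z =
      pd (Inl l) (\<lambda>z. p (\<xi> z) * (- (\<epsilon> $ k * \<alpha> $ k) * H (fibre_part z) $ a $ b)) z"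
    by (rule cong) (simp add: christoffel_base(4))
  also have "\<dots> = deriv p (\<xi> z) * \<alpha> $ l * (- (\<epsilon> $ k * \<alpha> $ k) * H (fibre_part z) $ a $ b)"
    by (rule pd_separated(1)[OF d(3) differentiable_mult[OF differentiable_const H_differentiable[OF y]]])
  finally show "pd (Inl l) (christoffel G (Inl k) (Inr a) (Inr b)) z =
      deriv p (\<xi> z) * \<alpha> $ l * (- (\<epsilon> $ k * \<alpha> $ k) * H (fibre_part z) $ a $ b)" .
  have "pd K (christoffel G (Inl k) (Inr a) (Inl i)) z = pd K (\<lambda>z. 0) z"
    by (rule cong) (rule christoffel_base(3))
  then show "pd K (christoffel G (Inl k) (Inr a) (Inl i)) z = 0"
    by simp
  have "pd (Inr e) (christoffel G (Inr a) (Inr b) (Inr b')) z =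
      pd (Inr e) (\<lambda>z. christoffel H a b b' (fibre_part z)) z"
    by (rule cong) (rule christoffel_fibre(4))
  also have "\<dots> = pd e (christoffel H a b b') (fibre_part z)"
    by (rule pd_fibre(2)[OF christoffel_differentiable[OF V H(1,3) y]])
  finally show "pd (Inr e) (christoffel G (Inr a) (Inr b) (Inr b')) z =
      pd e (christoffel H a b b') (fibre_part z)" .
qed

lemma sum_sum_type2:
  fixes F :: "'n + 'd \<Rightarrow> 'n + 'd \<Rightarrow> real"
  shows "(\<Sum>K\<in>UNIV. \<Sum>L\<in>UNIV. F K L) =
    (\<Sum>k\<in>UNIV. \<Sum>l\<in>UNIV. F (Inl k) (Inl l)) + (\<Sum>k\<in>UNIV. \<Sum>e\<in>UNIV. F (Inl k) (Inr e)) +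
    (\<Sum>b\<in>UNIV. \<Sum>l\<in>UNIV. F (Inr b) (Inl l)) + (\<Sum>b\<in>UNIV. \<Sum>e\<in>UNIV. F (Inr b) (Inr e))"
  by (simp add: sum_sum_type sum.distrib add_ac)

text \<open>Every term of the Ricci tensor in the base directions is a multiple of
  \<open>\<alpha>\<^sub>i \<alpha>\<^sub>j\<close>: a term that is not would carry the factor \<open>\<parallel>\<alpha>\<parallel>\<^sup>2 = 0\<close>. Only this shape
  matters later, since the trace of \<open>\<alpha>\<^sub>i \<alpha>\<^sub>j\<close> is again \<open>\<parallel>\<alpha>\<parallel>\<^sup>2\<close>.\<close>

lemma ricci_base:
  assumes "z \<in> W"
  shows "\<exists>\<kappa>. \<forall>i j. ricci G (Inl i) (Inl j) z = \<kappa> * (\<alpha> $ i * \<alpha> $ j)"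
proof -
  let ?N = "real CARD('n)" and ?D = "real CARD('d)" and ?t = "\<xi> z"
  note \<Gamma> = christoffel_base[OF assms] christoffel_fibre[OF assms]
  have "ricci G (Inl i) (Inl j) z = ((2 - ?N) * deriv c ?t - ?D * deriv m ?t
      + (?N - 2) * (c ?t)\<^sup>2 + 2 * ?D * m ?t * c ?t - ?D * (m ?t)\<^sup>2) * (\<alpha> $ i * \<alpha> $ j)" for i j
  proof -
    have "(\<Sum>k\<in>UNIV. deriv c ?t * \<alpha> $ k * conf k i j - deriv c ?t * \<alpha> $ j * conf k i k) =
        deriv c ?t * (\<Sum>k\<in>UNIV. \<alpha> $ k * conf k i j) - ?N * deriv c ?t * \<alpha> $ j * \<alpha> $ i"
      by (simp add: sum_subtractf sum_distrib_left mult.assoc)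
    then have 1: "(\<Sum>k\<in>UNIV. pd k (christoffel G k (Inl i) (Inl j)) z - pd (Inl j) (christoffel G k (Inl i) k) z)
        = ((2 - ?N) * deriv c ?t - ?D * deriv m ?t) * (\<alpha> $ i * \<alpha> $ j)"
      unfolding sum_sum_type pd_christoffel[OF assms] by (simp add: sum_conf_upper algebra_simps)
    \<comment> \<open>The quadratic terms are split by whether the two summed indices are base (L) or fibre (R)
      indices. The block LR vanishes termwise.\<close>
    have "(\<Sum>k\<in>UNIV. \<Sum>l\<in>UNIV. c ?t * conf k k l * (c ?t * conf l i j) - c ?t * conf k j l * (c ?t * conf l i k)) =
       (c ?t)\<^sup>2 * (?N * (\<Sum>l\<in>UNIV. \<alpha> $ l * conf l i j)) - (c ?t)\<^sup>2 * (\<Sum>k\<in>UNIV. \<Sum>l\<in>UNIV. conf k j l * conf l i k)"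
      by (simp add: sum_subtractf sum_distrib_left power2_eq_square mult_ac)
    then have LL: "(\<Sum>k\<in>UNIV. \<Sum>l\<in>UNIV. christoffel G (Inl k) (Inl k) (Inl l) z * christoffel G (Inl l) (Inl i) (Inl j) z
        - christoffel G (Inl k) (Inl j) (Inl l) z * christoffel G (Inl l) (Inl i) (Inl k) z) =
        (?N - 2) * (c ?t)\<^sup>2 * (\<alpha> $ i * \<alpha> $ j)"
      unfolding \<Gamma> sum_conf_conf sum_conf_upper by (simp add: algebra_simps)
    have "(\<Sum>l\<in>UNIV. m ?t * \<alpha> $ l * (c ?t * conf l i j)) = m ?t * c ?t * (\<Sum>l\<in>UNIV. \<alpha> $ l * conf l i j)"
      by (simp add: sum_distrib_left mult_ac)
    then have RL: "(\<Sum>b\<in>(UNIV::'d set). \<Sum>l\<in>UNIV. christoffel G (Inr b) (Inr b) (Inl l) z * christoffel G (Inl l) (Inl i) (Inl j) z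
        - christoffel G (Inr b) (Inl j) (Inl l) z * christoffel G (Inl l) (Inl i) (Inr b) z) =
        2 * ?D * m ?t * c ?t * (\<alpha> $ i * \<alpha> $ j)"
      unfolding \<Gamma> sum_conf_upper by simp
    have "m ?t * \<alpha> $ j * (if b = e then 1 else 0) * (m ?t * \<alpha> $ i * (if e = b then 1 else 0)) =
       (if e = b then (m ?t)\<^sup>2 * (\<alpha> $ i * \<alpha> $ j) else 0)" for b e :: 'd
      by (simp add: power2_eq_square)
    then have RR: "(\<Sum>b\<in>UNIV. \<Sum>e\<in>UNIV. christoffel G (Inr b) (Inr b) (Inr e) z * christoffel G (Inr e) (Inl i) (Inl j) z
        - christoffel G (Inr b) (Inl j) (Inr e) z * christoffel G (Inr e) (Inl i) (Inr b) z) =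
        - ?D * (m ?t)\<^sup>2 * (\<alpha> $ i * \<alpha> $ j)"
      unfolding \<Gamma>(5-8) by (simp add: sum_negf)
    show ?thesis
      unfolding ricci_def 1 sum_sum_type2 LL RL RR by (simp add: \<Gamma> algebra_simps)
  qed
  then show ?thesis by blast
qed

text \<open>The corrections to the Ricci tensor of the fibre that come from the warping pair the gradients of
  two functions of the null form, hence vanish.\<close>

lemma ricci_fibre:
  assumes "z \<in> W"
  shows "ricci G (Inr a) (Inr b) z = ricci H a b (fibre_part z)"
proof -
  let ?t = "\<xi> z" and ?y = "fibre_part z"
  note \<Gamma> = christoffel_base[OF assms] christoffel_fibre[OF assms]
  have null: "(\<Sum>l\<in>UNIV. x * (\<alpha> $ l * (\<epsilon> $ l * \<alpha> $ l))) = 0" for x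
    by (simp add: null_sum flip: sum_distrib_left)
  have "(\<Sum>k\<in>UNIV. deriv p ?t * \<alpha> $ k * (- (\<epsilon> $ k * \<alpha> $ k) * H ?y $ a $ b) - 0) =
      (\<Sum>k\<in>UNIV. (- deriv p ?t * H ?y $ a $ b) * (\<alpha> $ k * (\<epsilon> $ k * \<alpha> $ k)))"
    by (simp add: mult_ac)
  then have 1: "(\<Sum>k\<in>UNIV. pd k (christoffel G k (Inr a) (Inr b)) z - pd (Inr b) (christoffel G k (Inr a) k) z) =
      (\<Sum>e\<in>UNIV. pd e (christoffel H e a b) ?y - pd b (christoffel H e a e) ?y)"
    unfolding sum_sum_type pd_christoffel[OF assms] null by simp
  have "(\<Sum>l\<in>UNIV. c ?t * \<alpha> $ l * (- p ?t * (\<epsilon> $ l * \<alpha> $ l) * H ?y $ a $ b)) =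
      (\<Sum>l\<in>UNIV. (- c ?t * p ?t * H ?y $ a $ b) * (\<alpha> $ l * (\<epsilon> $ l * \<alpha> $ l)))"
    by (simp add: mult_ac)
  then have LL: "(\<Sum>k\<in>UNIV. \<Sum>l\<in>UNIV. christoffel G (Inl k) (Inl k) (Inl l) z * christoffel G (Inl l) (Inr a) (Inr b) z
        - christoffel G (Inl k) (Inr b) (Inl l) z * christoffel G (Inl l) (Inr a) (Inl k) z) = 0"
    unfolding \<Gamma> null by simp
  have "(\<Sum>k\<in>UNIV. p ?t * (\<epsilon> $ k * \<alpha> $ k) * x * (m ?t * \<alpha> $ k * y)) =
      (\<Sum>k\<in>UNIV. (p ?t * m ?t * x * y) * (\<alpha> $ k * (\<epsilon> $ k * \<alpha> $ k)))" for x y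
    by (simp add: mult_ac)
  \<comment> \<open>Each product of a normal component with a mixed symbol contracts the null form with itself.\<close>
  note cross = this[unfolded null]
  have "(\<Sum>k\<in>UNIV. \<Sum>e\<in>UNIV. p ?t * (\<epsilon> $ k * \<alpha> $ k) * H ?y $ b $ e * (m ?t * \<alpha> $ k * (if e = a then 1 else 0))) = 0"
    by (subst sum.swap) (simp only: cross sum.neutral_const)
  then have LR: "(\<Sum>k\<in>UNIV. \<Sum>e\<in>UNIV. christoffel G (Inl k) (Inl k) (Inr e) z * christoffel G (Inr e) (Inr a) (Inr b) z
        - christoffel G (Inl k) (Inr b) (Inr e) z * christoffel G (Inr e) (Inr a) (Inl k) z) = 0"
    unfolding \<Gamma> by simp
  have "m ?t * \<alpha> $ l * x * (- p ?t * (\<epsilon> $ l * \<alpha> $ l) * y) - m ?t * \<alpha> $ l * u * (- p ?t * (\<epsilon> $ l * \<alpha> $ l) * v) =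
      (m ?t * p ?t * (u * v - x * y)) * (\<alpha> $ l * (\<epsilon> $ l * \<alpha> $ l))" for l x y u v
    by (simp add: algebra_simps)
  then have RL: "(\<Sum>e\<in>UNIV. \<Sum>l\<in>UNIV. christoffel G (Inr e) (Inr e) (Inl l) z * christoffel G (Inl l) (Inr a) (Inr b) z
        - christoffel G (Inr e) (Inr b) (Inl l) z * christoffel G (Inl l) (Inr a) (Inr e) z) = 0"
    unfolding \<Gamma> by (simp only: null sum.neutral_const)
  show ?thesis
    unfolding ricci_def 1 sum_sum_type2 LL LR RL by (simp add: \<Gamma>)
qed

lemma scalar_curv_G:
  assumes "z \<in> W"
  shows "scalar_curv G z = scalar_curv H (fibre_part z) / (f (\<xi> z))\<^sup>2"
proof -
  obtain \<kappa> where \<kappa>: "\<And>i j. ricci G (Inl i) (Inl j) z = \<kappa> * (\<alpha> $ i * \<alpha> $ j)"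
    using ricci_base[OF assms] by blast
  have "(\<Sum>j\<in>UNIV. (\<phi> (\<xi> z))\<^sup>2 * diag_matrix \<epsilon> $ i $ j * (\<kappa> * (\<alpha> $ i * \<alpha> $ j))) =
      (\<phi> (\<xi> z))\<^sup>2 * \<kappa> * (\<alpha> $ i * (\<epsilon> $ i * \<alpha> $ i))" for i
    by (simp add: mult.assoc sum_diag_matrix flip: sum_distrib_left)
  then have "(\<Sum>i\<in>UNIV. \<Sum>j\<in>UNIV. (\<phi> (\<xi> z))\<^sup>2 * diag_matrix \<epsilon> $ i $ j * (\<kappa> * (\<alpha> $ i * \<alpha> $ j))) = 0"
    by (simp add: null_sum flip: sum_distrib_left)
  then show ?thesis
    unfolding scalar_curv_def sum_sum_type2 matrix_inv_G[OF assms]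
    by (simp add: \<kappa> ricci_fibre[OF assms] sum_divide_distrib)
qed

subsection \<open>The Hessian of a function of the linear form\<close>

text \<open>In the base directions the symbols contribute through \<open>\<Sum>\<^sub>k \<alpha>\<^sub>k conf\<^sub>k\<^sub>i\<^sub>j = 2 \<alpha>\<^sub>i \<alpha>\<^sub>j\<close>; in the fibre
  directions through the normal components, which pair to zero with the gradient of the
  potential.\<close>

lemma hess_G:
  assumes "z \<in> W" and h: "smooth_on I h"
  defines "t \<equiv> \<xi> z"
  shows "hess G (\<lambda>z. h (\<xi> z)) z $ Inl i $ Inl j =
      (deriv (deriv h) t - 2 * c t * deriv h t) * (\<alpha> $ i * \<alpha> $ j)"
    and "hess G (\<lambda>z. h (\<xi> z)) z $ Inl i $ Inr b = 0"
    and "hess G (\<lambda>z. h (\<xi> z)) z $ Inr b $ Inl i = 0"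
    and "hess G (\<lambda>z. h (\<xi> z)) z $ Inr a $ Inr b = 0"
proof -
  note \<Gamma> = christoffel_base[OF assms(1)] christoffel_fibre[OF assms(1)]
  note h' = smooth_on_deriv(1)[OF I h] and h'' = smooth_on_deriv(1)[OF I smooth_on_deriv(2)[OF I h]]
  have 1: "pd (Inl i) (\<lambda>z. h (\<xi> z)) z = deriv h (\<xi> z) * \<alpha> $ i" "pd (Inr b) (\<lambda>z. h (\<xi> z)) z = 0"
    if "z \<in> W" for i b z
    by (rule pd_profile[OF h'[OF W_D(1)[OF that]]])+
  have "pd K (pd (Inl j) (\<lambda>z. h (\<xi> z))) z = pd K (\<lambda>z. deriv h (\<xi> z) * \<alpha> $ j) z" for K j
    by (rule pd_cong[OF open_W assms(1)]) (rule 1)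
  then have 2: "pd (Inl i) (pd (Inl j) (\<lambda>z. h (\<xi> z))) z = deriv (deriv h) t * \<alpha> $ i * \<alpha> $ j"
    "pd (Inr b) (pd (Inl j) (\<lambda>z. h (\<xi> z))) z = 0" for i j b
    using pd_separated[OF h''[OF W_D(1)[OF assms(1)]], of "\<lambda>_. \<alpha> $ j"] by (simp_all add: t_def)
  have "pd K (pd (Inr b) (\<lambda>z. h (\<xi> z))) z = pd K (\<lambda>z. 0) z" for K b
    by (rule pd_cong[OF open_W assms(1)]) (rule 1)
  then have 3: "pd K (pd (Inr b) (\<lambda>z. h (\<xi> z))) z = 0" for K b
    by simp
  have "(\<Sum>k\<in>UNIV. c t * conf k i j * (deriv h t * \<alpha> $ k)) =
      c t * deriv h t * (\<Sum>k\<in>UNIV. \<alpha> $ k * conf k i j)"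
    by (simp add: sum_distrib_left mult_ac)
  then show "hess G (\<lambda>z. h (\<xi> z)) z $ Inl i $ Inl j =
      (deriv (deriv h) t - 2 * c t * deriv h t) * (\<alpha> $ i * \<alpha> $ j)"
    by (simp add: hess_def sum_sum_type \<Gamma> 1[OF assms(1)] 2 sum_conf_upper algebra_simps flip: t_def)
  show "hess G (\<lambda>z. h (\<xi> z)) z $ Inl i $ Inr b = 0" "hess G (\<lambda>z. h (\<xi> z)) z $ Inr b $ Inl i = 0"
    by (simp_all add: hess_def sum_sum_type \<Gamma> 1[OF assms(1)] 2 3)
  have "(\<Sum>k\<in>UNIV. p t * (\<epsilon> $ k * \<alpha> $ k) * H (fibre_part z) $ a $ b * (deriv h t * \<alpha> $ k)) =
      p t * H (fibre_part z) $ a $ b * deriv h t * (\<Sum>k\<in>UNIV. \<alpha> $ k * (\<epsilon> $ k * \<alpha> $ k))"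
    by (simp add: sum_distrib_left mult_ac)
  then show "hess G (\<lambda>z. h (\<xi> z)) z $ Inr a $ Inr b = 0"
    by (simp add: hess_def sum_sum_type \<Gamma> 1[OF assms(1)] 3 null_sum sum_negf flip: t_def)
qed

end

section \<open>The soliton equation\<close>

text \<open>The left-hand side times \<open>\<phi>\<^sup>2\<close> is the derivative of \<open>h' \<phi>\<^sup>2\<close>, and the interval is connected.\<close>

lemma soliton_ode_iff:
  fixes \<phi> h :: "real \<Rightarrow> real" and a b :: ereal
  assumes "a < b" and \<phi>: "smooth_on (einterval a b) \<phi>" "\<And>t. t \<in> einterval a b \<Longrightarrow> \<phi> t > 0"
    and h: "smooth_on (einterval a b) h"
  shows "(\<forall>t\<in>einterval a b. deriv (deriv h) t + 2 * (deriv \<phi> t / \<phi> t) * deriv h t = 0) \<longleftrightarrow>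
    (\<exists>k. \<forall>t\<in>einterval a b. (h has_real_derivative k / (\<phi> t)\<^sup>2) (at t))"
proof -
  let ?I = "einterval a b"
  note d = smooth_on_deriv(1)[OF open_einterval h] smooth_on_deriv(1)[OF open_einterval \<phi>(1)]
    smooth_on_deriv(1)[OF open_einterval smooth_on_deriv(2)[OF open_einterval h]]
  have product: "((\<lambda>t. deriv h t * (\<phi> t)\<^sup>2) has_real_derivative
      (deriv (deriv h) t + 2 * (deriv \<phi> t / \<phi> t) * deriv h t) * (\<phi> t)\<^sup>2) (at t)" if "t \<in> ?I" for t
    using \<phi>(2)[OF that]
    by (auto intro!: derivative_eq_intros d[OF that] simp: field_simps power2_eq_square)
  have const: "(\<forall>t\<in>?I. deriv (deriv h) t + 2 * (deriv \<phi> t / \<phi> t) * deriv h t = 0) \<longleftrightarrow>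
      (\<exists>k. \<forall>t\<in>?I. deriv h t * (\<phi> t)\<^sup>2 = k)"
  proof
    assume "\<forall>t\<in>?I. deriv (deriv h) t + 2 * (deriv \<phi> t / \<phi> t) * deriv h t = 0"
    then have "((\<lambda>t. deriv h t * (\<phi> t)\<^sup>2) has_real_derivative 0) (at t within ?I)" if "t \<in> ?I" for t
      using product[OF that] that by (simp add: has_field_derivative_at_within)
    moreover have "convex ?I"
    proof -
      have "x \<in> ?I" if "s \<in> ?I" "u \<in> ?I" "s \<le> x" "x \<le> u" for s u x
        using that less_le_trans[of a "ereal s" "ereal x"] le_less_trans[of "ereal x" "ereal u" b]
        by (simp add: einterval_iff)
      then show ?thesis
        unfolding is_interval_convex_1[symmetric] is_interval_1 by blast
    qed
    ultimately show "\<exists>k. \<forall>t\<in>?I. deriv h t * (\<phi> t)\<^sup>2 = k"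
      using has_field_derivative_zero_constant[of ?I "\<lambda>t. deriv h t * (\<phi> t)\<^sup>2"] by blast
  next
    assume "\<exists>k. \<forall>t\<in>?I. deriv h t * (\<phi> t)\<^sup>2 = k"
    then obtain k where k: "\<And>t. t \<in> ?I \<Longrightarrow> deriv h t * (\<phi> t)\<^sup>2 = k"
      by blast
    show "\<forall>t\<in>?I. deriv (deriv h) t + 2 * (deriv \<phi> t / \<phi> t) * deriv h t = 0"
    proof
      fix t assume t: "t \<in> ?I"
      have "((\<lambda>t. k) has_real_derivative
          (deriv (deriv h) t + 2 * (deriv \<phi> t / \<phi> t) * deriv h t) * (\<phi> t)\<^sup>2) (at t)"
        by (rule has_field_derivative_transform_within_open[OF product[OF t] open_einterval t k])
      then have "(deriv (deriv h) t + 2 * (deriv \<phi> t / \<phi> t) * deriv h t) * (\<phi> t)\<^sup>2 = 0"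
        using DERIV_const DERIV_unique by blast
      then show "deriv (deriv h) t + 2 * (deriv \<phi> t / \<phi> t) * deriv h t = 0"
        using \<phi>(2)[OF t] by simp
    qed
  qed
  have "deriv h t * (\<phi> t)\<^sup>2 = k \<longleftrightarrow> (h has_real_derivative k / (\<phi> t)\<^sup>2) (at t)" if "t \<in> ?I" for t k
  proof -
    have "deriv h t * (\<phi> t)\<^sup>2 = k \<longleftrightarrow> deriv h t = k / (\<phi> t)\<^sup>2"
      using \<phi>(2)[OF that] by (simp add: field_simps)
    also have "\<dots> \<longleftrightarrow> (h has_real_derivative k / (\<phi> t)\<^sup>2) (at t)"
      using d(1)[OF that] DERIV_imp_deriv by metis
    finally show ?thesis .
  qed
  with const show ?thesis by simp
qed

theorem theorem1p12:
  fixes \<epsilon> \<alpha> :: "real^'n::finite"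
    and \<xi> :: "real^'n \<Rightarrow> real"
    and F :: "('i, 'p, 'd::finite) atlas"
    and gF :: "('i, 'p, 'd) tensor2"
    and a b :: ereal
    and \<phi> f h :: "real \<Rightarrow> real"
  assumes "CARD('n) \<ge> 3"
    and "\<And>i. \<epsilon> $ i = 1 \<or> \<epsilon> $ i = -1"
    and "semi_riemannian_manifold F gF"
    and "topspace (mtop F) \<noteq> {}"
    and "constant_scalar_curvature F gF 0"
    and "\<alpha> \<noteq> 0"
    and "\<And>x. \<xi> x = (\<Sum>i\<in>UNIV. \<alpha> $ i * x $ i)"
    and "(\<Sum>i\<in>UNIV. \<epsilon> $ i * (\<alpha> $ i)\<^sup>2) = 0"
    and "a < b"
    and "smooth_on (einterval a b) \<phi>" and "\<And>t. t \<in> einterval a b \<Longrightarrow> \<phi> t > 0"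
    and "smooth_on (einterval a b) f" and "\<And>t. t \<in> einterval a b \<Longrightarrow> f t > 0"
    and "smooth_on (einterval a b) h" and "\<And>t. t \<in> einterval a b \<Longrightarrow> h t > 0"
  shows "steady_gradient_Yamabe_soliton
           (product_manifold (open_submanifold (\<xi> -` einterval a b)) F)
           (warped_metric (\<lambda>_ x. (1 / (\<phi> (\<xi> x))\<^sup>2) *\<^sub>R diag_matrix \<epsilon>) (\<lambda>x. f (\<xi> x)) gF)
           (\<lambda>(x, q). h (\<xi> x))
         \<longleftrightarrow> (\<exists>k1::real. \<forall>t\<in>einterval a b. (h has_real_derivative k1 / (\<phi> t)\<^sup>2) (at t))"
proof -
  let ?I = "einterval a b"
  let ?U = "\<xi> -` ?I"
  let ?B = "open_submanifold ?U"
  let ?M = "product_manifold ?B F"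
  let ?gB = "\<lambda>(_::unit) x. (1 / (\<phi> (\<xi> x))\<^sup>2) *\<^sub>R diag_matrix \<epsilon>"
  let ?g = "warped_metric ?gB (\<lambda>x. f (\<xi> x)) gF"
  let ?u = "\<lambda>(x, q). h (\<xi> x)"
  note pos = assms(11,13)
  have \<xi>_eq: "\<xi> = (\<lambda>x. \<alpha> \<bullet> x)"
    using assms(7) by (auto simp: inner_vec_def)
  have \<xi>: "linear \<xi>" "continuous_on UNIV \<xi>"
    unfolding \<xi>_eq by (auto simp: linear_iff inner_add_right intro!: continuous_intros)
  have U: "open ?U"
    by (rule open_vimage[OF open_einterval \<xi>(2)])
  have smooth_compose: "smooth_on ?U (\<lambda>x. w (\<xi> x))" if "smooth_on ?I w" for w :: "real \<Rightarrow> real"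
    by (rule smooth_on_compose_linear[OF U \<xi>(1) open_einterval _ that]) auto
  have F: "smooth_manifold F" "semi_riemannian_metric F gF"
    using assms(3) by (auto simp: semi_riemannian_manifold_def)
  have B: "smooth_manifold ?B"
    by (rule smooth_manifold_open_submanifold[OF U])
  have pos_U: "\<phi> (\<xi> x) > 0" if "x \<in> ?U" for x
    using pos(1) that by simp
  have conformal: "smooth_on ?U (\<lambda>x. 1 / (\<phi> (\<xi> x))\<^sup>2)"
  proof -
    note sm = smooth_compose[OF assms(10)]
    have "smooth_on ?U (\<lambda>x. 1 / (\<phi> (\<xi> x) *\<^sub>R \<phi> (\<xi> x)))"
      by (rule smooth_on_inverse[OF U _ smooth_on_scaleR[OF U sm sm]]) (use pos_U in force)
    then show ?thesis
      by (simp add: power2_eq_square)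
  qed
  have gB: "semi_riemannian_metric ?B ?gB"
    by (rule semi_riemannian_metric_conformally_flat[OF U conformal _ assms(2)]) (use pos_U in force)
  have smooth_B: "smooth_function ?B (\<lambda>x. w (\<xi> x))" if "smooth_on ?I w" for w
    unfolding smooth_function_def
  proof
    fix i
    show "smooth_on (cimage ?B i) ((\<lambda>x. w (\<xi> x)) \<circ> param ?B i)"
      unfolding open_submanifold_simps by (rule smooth_on_cong[OF U _ smooth_compose[OF that]]) simp
  qed
  have manifold: "semi_riemannian_manifold ?M ?g"
    unfolding semi_riemannian_manifold_def
  proof
    show "smooth_manifold ?M"
      by (rule smooth_manifold_product[OF B F(1)])
    show "semi_riemannian_metric ?M ?g"
      by (rule semi_riemannian_metric_warped[OF B F(1) gB F(2) smooth_B[OF assms(12)]])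
        (use pos(2) in auto)
  qed
  have in_chart: "param ?M (i, j) z = (base_part z, param F j (fibre_part z))"
    if "j \<in> charts F" "z \<in> split_product ?U (cimage F j)" for i j z
    using param_product[OF B F(1), of i j z] that by (simp add: split_product_def)
  have potential: "smooth_function ?M ?u"
    unfolding smooth_function_def
  proof
    fix k assume "k \<in> charts ?M"
    then obtain i j where k: "k = (i, j)" and j: "j \<in> charts F"
      by (cases k) auto
    note o = open_cimage[OF F(1) j]
    show "smooth_on (cimage ?M k) (?u \<circ> param ?M k)"
      unfolding k cimage_product open_submanifold_simps
      by (rule smooth_on_cong[OF open_split_product[OF U o] _
            smooth_on_split(1)[OF U o smooth_compose[OF assms(14)]]])
        (simp add: in_chart[OF j])
  qed
  have equation: "(scalar_curvature ?M ?g (i, j) (x, q) - 0) *\<^sub>R ?g (i, j) (x, q) = Hessian ?M ?g ?u (i, j) (x, q)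
      \<longleftrightarrow> deriv (deriv h) (\<xi> x) + 2 * (deriv \<phi> (\<xi> x) / \<phi> (\<xi> x)) * deriv h (\<xi> x) = 0"
    if j: "j \<in> charts F" and x: "x \<in> ?U" and q: "q \<in> cdom F j" for i j x q
  proof -
    let ?V = "cimage F j" and ?H = "gF j \<circ> param F j"
    interpret L: null_warped_coordinates \<epsilon> \<alpha> \<phi> f ?I ?V ?H
    proof
      show "smooth_on ?V ?H"
        using F(2) j by (simp add: semi_riemannian_metric_def smooth_tensor2_def)
      show "transpose (?H y) = ?H y" "invertible (?H y)" if "y \<in> ?V" for y
        using F(2) j param_in_cdom[OF F(1) that] by (simp_all add: semi_riemannian_metric_def)
    qed (use assms open_cimage[OF F(1) j] in auto)
    let ?z = "join x (coord F j q)"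
    have L\<xi>: "L.\<xi> z = \<xi> (base_part z)" for z
      by (simp add: L.\<xi>_def \<xi>_eq)
    have W: "L.W = split_product ?U ?V"
      by (simp add: L.W_def \<xi>_eq vimage_def)
    have G: "(?g (i, j) \<circ> param ?M (i, j)) z = L.G z" if "z \<in> L.W" for z
      using that unfolding W by (simp add: in_chart[OF j] L.G_def L\<xi> warped_metric_def)
    have u: "(?u \<circ> param ?M (i, j)) z = h (L.\<xi> z)" if "z \<in> L.W" for z
      using that unfolding W by (simp add: in_chart[OF j] L\<xi>)
    have z: "?z \<in> L.W"
      unfolding W using x q by (simp add: split_product_def cimage_def)
    have "scalar_curv ?H (coord F j q) = 0"
      using assms(5) j q by (simp add: constant_scalar_curvature_def scalar_curvature_def)
    moreover have "scalar_curv (?g (i, j) \<circ> param ?M (i, j)) ?z = scalar_curv L.G ?z"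
      by (rule scalar_curv_cong[OF L.open_W _ z]) (rule G)
    ultimately have "scalar_curvature ?M ?g (i, j) (x, q) = 0"
      using L.scalar_curv_G[OF z] by (simp add: scalar_curvature_def)
    moreover have "Hessian ?M ?g ?u (i, j) (x, q) = hess L.G (\<lambda>z. h (L.\<xi> z)) ?z"
    proof -
      have "hess (?g (i, j) \<circ> param ?M (i, j)) (?u \<circ> param ?M (i, j)) ?z = hess L.G (\<lambda>z. h (L.\<xi> z)) ?z"
        by (rule hess_cong[OF L.open_W _ z]; (rule G | rule u))
      then show ?thesis
        by (simp add: Hessian_def)
    qed
    moreover obtain i0 where "\<alpha> $ i0 \<noteq> 0"
      using assms(6) by (auto simp: vec_eq_iff)
    ultimately show ?thesis
      using L.hess_G[OF z assms(14)]
      by (auto simp: vec_eq_sum_type_iff L\<xi> L.c_def)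
  qed
  \<comment> \<open>A nonzero linear form is onto, so an identity in \<open>\<xi> x\<close> is an identity on the interval.\<close>
  have "\<exists>x\<in>?U. \<xi> x = t" if "t \<in> ?I" for t
  proof -
    obtain i where "\<alpha> $ i \<noteq> 0"
      using assms(6) by (auto simp: vec_eq_iff)
    then have "\<xi> ((t / \<alpha> $ i) *\<^sub>R axis i 1) = t"
      by (simp add: \<xi>_eq inner_axis)
    with that show ?thesis by auto
  qed
  then have onto: "(\<forall>x\<in>?U. P (\<xi> x)) \<longleftrightarrow> (\<forall>t\<in>?I. P t)" for P
    by (metis vimageE)
  obtain j q where jq: "j \<in> charts F" "q \<in> cdom F j"
    using assms(4) F(1) unfolding smooth_manifold_def by blast
  have "steady_gradient_Yamabe_soliton ?M ?g ?u \<longleftrightarrow>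
      (\<forall>k\<in>charts ?M. \<forall>z\<in>cdom ?M k. (scalar_curvature ?M ?g k z - 0) *\<^sub>R ?g k z = Hessian ?M ?g ?u k z)"
    unfolding steady_gradient_Yamabe_soliton_def gradient_Yamabe_soliton_def
    using manifold potential by blast
  also have "\<dots> \<longleftrightarrow> (\<forall>j\<in>charts F. \<forall>x\<in>?U. \<forall>q\<in>cdom F j.
      (scalar_curvature ?M ?g ((), j) (x, q) - 0) *\<^sub>R ?g ((), j) (x, q) = Hessian ?M ?g ?u ((), j) (x, q))"
    by (auto simp del: vimage_eq)
  \<comment> \<open>The fibre is nonempty, so the equation on the product gives the one on the base.\<close>
  also have "\<dots> \<longleftrightarrow> (\<forall>x\<in>?U. deriv (deriv h) (\<xi> x) + 2 * (deriv \<phi> (\<xi> x) / \<phi> (\<xi> x)) * deriv h (\<xi> x) = 0)"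
    using equation jq by blast
  also have "\<dots> \<longleftrightarrow> (\<forall>t\<in>?I. deriv (deriv h) t + 2 * (deriv \<phi> t / \<phi> t) * deriv h t = 0)"
    by (rule onto)
  also have "\<dots> \<longleftrightarrow> (\<exists>k1. \<forall>t\<in>?I. (h has_real_derivative k1 / (\<phi> t)\<^sup>2) (at t))"
    by (rule soliton_ode_iff[OF assms(9-11,14)])
  finally show ?thesis .
qed

end
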